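(* For every integer $k\ge 3$ there exists $\epsilon_k>0$ such that $$\frac{1}{2k(k-1)}-o(1)\le \frac{{\rm inv}_k(n)}{n^2}\le \frac{1}{2\lfloor k^2/2\rfloor}-\epsilon_k+o(1).$$ Moreover, there exists $k_0$ such that for every $k\ge k_0$ there exists $\delta_k>0$ with $$\frac{{\rm inv}_k(n)}{n^2}\ge \frac{1}{2k(k-1)}+\delta_k-o(1).$$ Here $o(1)\to 0$ as $n\to\infty$ with $k$ fixed.
   Context: For an oriented graph $D$ and $X\subseteq V(D)$, inverting $X$ means reversing the direction of every edge of $D$ with both endpoints in $X$. A set $\{X_1,\dots,X_t\}$ of vertex subsets is $k$-decycling for $D$ if every $X_i$ has size at most $k$ and inverting $X_1,\dots,X_t$ yields an acyclic digraph. ${\rm inv}_k(D)$ is the minimum size of a $k$-decycling set of $D$, and ${\rm inv}_k(n)$ is the maximum of ${\rm inv}_k(D)$ over all oriented graphs (equivalently, all tournaments) $D$ on $n$ vertices. *)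

theory Defs
  imports Complex_Main "HOL-Library.Landau_Symbols" "Graph_Theory.Pair_Digraph"
begin

text \<open>Asymmetry of the arc relation excludes loops as well as cycles of length two.\<close>

locale oriented_graph = pair_fin_digraph D for D :: "'a pair_pre_digraph" +
  assumes asym_arcs: "asym (parcs D)"

definition invert :: "'a set \<Rightarrow> 'a pair_pre_digraph \<Rightarrow> 'a pair_pre_digraph" where
  "invert X D = D\<lparr>parcs := (parcs D - X \<times> X) \<union> (parcs D \<inter> X \<times> X)\<inverse>\<rparr>"

lemma pverts_invert [simp]: "pverts (invert X D) = pverts D"
  by (simp add: invert_def)

lemma in_parcs_invert_iff:
  "(u, v) \<in> parcs (invert X D) \<longleftrightarrow>
     (if u \<in> X \<and> v \<in> X then (v, u) \<in> parcs D else (u, v) \<in> parcs D)"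
  by (auto simp: invert_def)

lemma invert_commute: "invert X (invert Y D) = invert Y (invert X D)"
proof -
  have "parcs (invert X (invert Y D)) = parcs (invert Y (invert X D))"
    by (auto simp: in_parcs_invert_iff split: if_splits)
  then show ?thesis
    by (simp add: invert_def)
qed

text \<open>
  Inversions commute, so the members of a finite family can be inverted one after the other
  in any order.
\<close>

interpretation invert: comp_fun_commute invert
  by unfold_locales (simp add: fun_eq_iff invert_commute)

definition invert_family :: "'a set set \<Rightarrow> 'a pair_pre_digraph \<Rightarrow> 'a pair_pre_digraph" where
  "invert_family F D = Finite_Set.fold invert D F"

definition decycling :: "nat \<Rightarrow> 'a pair_pre_digraph \<Rightarrow> 'a set set \<Rightarrow> bool" where
  "decycling k D F \<longleftrightarrow>
     (\<forall>X\<in>F. X \<subseteq> pverts D \<and> card X \<le> k) \<and> acyclic (parcs (invert_family F D))"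

text \<open>
  The minimum is over a nonempty set if \<open>k \<ge> 2\<close>
  (see \<open>decycling_exists\<close> below); smaller \<open>k\<close> are of no interest.
\<close>

definition inv_num :: "nat \<Rightarrow> 'a pair_pre_digraph \<Rightarrow> nat" where
  "inv_num k D = (LEAST t. \<exists>F. decycling k D F \<and> card F = t)"

text \<open>
  Every oriented graph is isomorphic to one whose vertices are natural numbers. The maximum is
  over a finite nonempty set if \<open>k \<ge> 2\<close>
  (see \<open>finite_inv_nums\<close> and \<open>inv_nums_nonempty\<close> below).
\<close>

definition max_inv_num :: "nat \<Rightarrow> nat \<Rightarrow> nat" where
  "max_inv_num k n =
     Max {inv_num k D | D :: nat pair_pre_digraph. oriented_graph D \<and> card (pverts D) = n}"

lemma in_parcs_invert_family_iff:
  assumes "finite F"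
  shows "(u, v) \<in> parcs (invert_family F D) \<longleftrightarrow>
    (if even (card {X \<in> F. u \<in> X \<and> v \<in> X}) then (u, v) \<in> parcs D else (v, u) \<in> parcs D)"
  using assms
proof (induction F arbitrary: u v rule: finite_induct)
  case empty
  then show ?case by (simp add: invert_family_def)
next
  case (insert Y F)
  have "invert_family (insert Y F) D = invert Y (invert_family F D)"
    using insert.hyps by (simp add: invert_family_def)
  moreover have "{X \<in> insert Y F. u \<in> X \<and> v \<in> X} =
    (if u \<in> Y \<and> v \<in> Y then insert Y {X \<in> F. u \<in> X \<and> v \<in> X} else {X \<in> F. u \<in> X \<and> v \<in> X})"
    by auto
  moreover have "{X \<in> F. v \<in> X \<and> u \<in> X} = {X \<in> F. u \<in> X \<and> v \<in> X}"
    by auto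
  ultimately show ?case
    using insert.hyps insert.IH[of u v] insert.IH[of v u]
    by (auto simp: in_parcs_invert_iff)
qed

lemma decycling_exists:
  assumes "oriented_graph D" and "k \<ge> 2"
  shows "\<exists>F. decycling k D F \<and> card F \<le> card (pverts D) * card (pverts D)"
proof -
  interpret oriented_graph D by fact
  have fin: "finite (pverts D)" by (rule pair_finite_verts)
  then obtain f :: "'a \<Rightarrow> nat" where f: "inj_on f (pverts D)"
    using finite_imp_inj_to_nat_seg by metis
  define B where "B = {e \<in> parcs D. f (snd e) < f (fst e)}"
  define F where "F = (\<lambda>e. {fst e, snd e}) ` B"
  have sub: "B \<subseteq> pverts D \<times> pverts D"
    by (auto simp: B_def dest: in_arcsD1 in_arcsD2)
  then have finB: "finite B" using fin by (meson finite_SigmaI finite_subset)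
  then have finF: "finite F" by (simp add: F_def)
  have "card F \<le> card B" unfolding F_def by (rule card_image_le[OF finB])
  also have "\<dots> \<le> card (pverts D) * card (pverts D)"
    using card_mono[OF _ sub] fin by (simp add: card_cartesian_product)
  finally have cF: "card F \<le> card (pverts D) * card (pverts D)" .
  have "f u < f v" if uv: "(u, v) \<in> parcs (invert_family F D)" for u v
  proof -
    have arc: "(u, v) \<in> parcs D \<or> (v, u) \<in> parcs D"
      using uv in_parcs_invert_family_iff[OF finF] by (auto split: if_splits)
    then have ne: "u \<noteq> v" using asym_arcs by (auto dest: asymD)
    have inV: "u \<in> pverts D" "v \<in> pverts D" using arc by (auto dest: in_arcsD1 in_arcsD2)
    with f ne have fne: "f u \<noteq> f v" by (auto dest: inj_onD)
    have pair: "{X \<in> F. u \<in> X \<and> v \<in> X} = F \<inter> {{u, v}}"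
      using ne by (auto simp: F_def)
    have mem: "{u, v} \<in> F \<longleftrightarrow> (u, v) \<in> B \<or> (v, u) \<in> B"
      by (auto simp: F_def image_iff doubleton_eq_iff; force)
    show ?thesis
    proof (cases "{u, v} \<in> F")
      case True
      then have "(v, u) \<in> parcs D"
        using uv in_parcs_invert_family_iff[OF finF, of u v D] pair by simp
      moreover from this have "(u, v) \<notin> parcs D" using asym_arcs by (auto dest: asymD)
      ultimately show ?thesis using True mem by (auto simp: B_def)
    next
      case False
      then have "(u, v) \<in> parcs D"
        using uv in_parcs_invert_family_iff[OF finF, of u v D] pair by simp
      then show ?thesis using False mem fne by (auto simp: B_def)
    qed
  qed
  then have "parcs (invert_family F D) \<subseteq> measure f" by auto
  then have "acyclic (parcs (invert_family F D))"
    using wf_acyclic[OF wf_measure] acyclic_subset by blast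
  moreover have "\<forall>X\<in>F. X \<subseteq> pverts D \<and> card X \<le> k"
    using sub assms(2) by (auto simp: F_def intro: le_trans[OF card_insert_le_m1[of 2]])
  ultimately show ?thesis using cF by (auto simp: decycling_def)
qed

lemma finite_inv_nums:
  assumes "k \<ge> 2"
  shows "finite {inv_num k D | D :: 'a pair_pre_digraph. oriented_graph D \<and> card (pverts D) = n}"
proof (rule finite_subset)
  show "{inv_num k D | D :: 'a pair_pre_digraph. oriented_graph D \<and> card (pverts D) = n} \<subseteq> {..n * n}"
  proof (rule subsetI)
    fix m
    assume "m \<in> {inv_num k D | D :: 'a pair_pre_digraph. oriented_graph D \<and> card (pverts D) = n}"
    then obtain D :: "'a pair_pre_digraph"
      where D: "m = inv_num k D" "oriented_graph D" "card (pverts D) = n"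
      by blast
    then obtain F where F: "decycling k D F" "card F \<le> n * n"
      using decycling_exists assms by blast
    have "inv_num k D \<le> card F"
      unfolding inv_num_def by (rule Least_le) (use F in blast)
    then show "m \<in> {..n * n}" using D F by simp
  qed
qed simp

lemma inv_nums_nonempty:
  "{inv_num k D | D :: nat pair_pre_digraph. oriented_graph D \<and> card (pverts D) = n} \<noteq> {}"
proof -
  have "oriented_graph \<lparr>pverts = {..<n}, parcs = {}\<rparr>"
    by unfold_locales (auto simp: asym_on_def)
  then show ?thesis
    by (auto intro!: exI[of _ "\<lparr>pverts = {..<n}, parcs = {}\<rparr>"])
qed

end

theory Submission
  imports Defs "HOL-Library.Ramsey" "HOL-Real_Asymp.Real_Asymp"
begin

text \<open>
  Upper bound: four sets, each made of one half of \<open>A\<close> and one half of \<open>B\<close>, reverse exactly the pairs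
  of a complete bipartite graph between \<open>A\<close> and \<open>B\<close>, since pairs inside a half are reversed twice.
  By the Kovari-Sos-Turan theorem any graph with \<open>e\<close> edges can therefore be reversed with
  \<open>e / \<lfloor>k\<^sup>2/4\<rfloor> + o(n\<^sup>2)\<close> sets, and a vertex order or its reverse has at most \<open>n\<^sup>2/4\<close> backward arcs.
  The gain \<open>\<epsilon>\<close> comes from a packing of quadratically many edge-disjoint transitive \<open>k\<close>-sets: some order
  makes a constant fraction of them completely backward, and each of these takes a single set
  instead of \<open>(k choose 2) / \<lfloor>k\<^sup>2/4\<rfloor> > 1\<close>.

  Lower bound: a random tournament \<open>R\<close> on \<open>r\<close> vertices has no feedback arc set smaller than
  \<open>(1/4 - o(1)) r\<^sup>2\<close> and no transitive subtournament on more than \<open>O(log r)\<close> vertices. In its blow-up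
  with independent parts, a set of size \<open>k\<close> contains at most \<open>k choose 2\<close> arcs of an acyclic
  subdigraph, and by Turan's theorem at most \<open>(1 - 1/w) k\<^sup>2/2\<close> if \<open>R\<close> has no transitive subtournament
  on \<open>w + 1\<close> vertices. As \<open>1/w\<close> exceeds the relative deficit in the feedback arc set bound, the
  second estimate yields the gain \<open>\<delta>\<close> for large \<open>k\<close>.
\<close>

subsection \<open>Extremal graph theory\<close>

text \<open>Induction on \<open>w\<close>. For a vertex \<open>v\<close> of maximum degree, the
  neighbourhood \<open>N\<close> has no clique on one vertex fewer, since \<open>v\<close> would
  extend it; this bounds the edges inside \<open>N\<close>, and the others are bounded by the
  degrees outside \<open>N\<close>.\<close>

theorem turan_bound:
  fixes E :: "'a set set"
  assumes "1 \<le> w" "finite V" "E \<subseteq> nsets V 2"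
    and "\<And>C. C \<subseteq> V \<Longrightarrow> card C = Suc w \<Longrightarrow> \<not> nsets C 2 \<subseteq> E"
  shows "real (card E) \<le> (1 - 1 / real w) * (real (card V))\<^sup>2 / 2"
  using assms
proof (induction w arbitrary: V E rule: nat_induct_at_least)
  case base
  have "E = {}"
  proof (rule ccontr)
    assume "E \<noteq> {}"
    then obtain e where "e \<in> E" by blast
    with base.prems(2) have e2: "e \<in> nsets V 2" by blast
    then have "nsets e 2 = {e}" by (auto elim!: nsets2_E)
    then have "e \<subseteq> V" "card e = Suc 1" "nsets e 2 \<subseteq> E"
      using e2 \<open>e \<in> E\<close> by (auto simp: nsets_def)
    then show False using base.prems(3) by blast
  qed
  then show ?case by simp
next
  case (Suc w)
  show ?case
  proof (cases "V = {}")
    case True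
    then have "E = {}" using Suc.prems(2) by (auto simp: nsets_def)
    then show ?thesis by simp
  next
    case False
    define deg where "deg v = card {e \<in> E. v \<in> e}" for v
    have finE: "finite E"
      using Suc.prems(1,2) finite_imp_finite_nsets finite_subset by metis
    have "Max (deg ` V) \<in> deg ` V" using Suc.prems(1) False by (intro Max_in) auto
    then obtain v where v: "v \<in> V" and "deg v = Max (deg ` V)" by auto
    then have vmax: "\<And>u. u \<in> V \<Longrightarrow> deg u \<le> deg v" using Suc.prems(1) by simp
    define N where "N = {u \<in> V. {v, u} \<in> E}"
    have vN: "v \<notin> N" using Suc.prems(2) by (auto simp: N_def nsets_def)
    have NV: "N \<subseteq> V" and finN: "finite N" using Suc.prems(1) by (auto simp: N_def)
    have "{e \<in> E. v \<in> e} = (\<lambda>u. {v, u}) ` N"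
    proof (intro equalityI subsetI)
      fix e assume e: "e \<in> {e \<in> E. v \<in> e}"
      then obtain x y where "e = {x, y}" "x \<in> V" "y \<in> V" "x \<noteq> y"
        using Suc.prems(2) by (blast elim: nsets2_E)
      with e show "e \<in> (\<lambda>u. {v, u}) ` N" by (auto simp: N_def insert_commute)
    qed (auto simp: N_def)
    moreover have "inj_on (\<lambda>u. {v, u}) N"
      by (auto simp: inj_on_def doubleton_eq_iff)
    ultimately have degv: "deg v = card N"
      by (simp add: deg_def card_image)
    have IH: "real (card (E \<inter> nsets N 2)) \<le> (1 - 1 / real w) * (real (card N))\<^sup>2 / 2"
    proof (rule Suc.IH)
      fix C assume C: "C \<subseteq> N" "card C = Suc w"
      show "\<not> nsets C 2 \<subseteq> E \<inter> nsets N 2"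
      proof
        assume CE: "nsets C 2 \<subseteq> E \<inter> nsets N 2"
        have "nsets (insert v C) 2 \<subseteq> E"
        proof
          fix e assume "e \<in> nsets (insert v C) 2"
          then obtain x y where xy: "e = {x, y}" "x \<in> insert v C" "y \<in> insert v C" "x \<noteq> y"
            by (blast elim: nsets2_E)
          show "e \<in> E"
          proof (cases "x = v \<or> y = v")
            case True
            then obtain u where "u \<in> C" "e = {v, u}"
              using xy(1-4) by (metis insertE insert_commute)
            then show ?thesis using C(1) unfolding N_def by blast
          next
            case False
            with xy have "e \<in> nsets C 2" by auto
            with CE show ?thesis by blast
          qed
        qed
        moreover have "card (insert v C) = Suc (Suc w)"
          using C vN finN by (metis card_insert_disjoint finite_subset subsetD)
        ultimately show False
          using Suc.prems(3)[of "insert v C"] C(1) NV v by blast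
      qed
    qed (use finN in auto)
    \<comment> \<open>Every edge not inside \<open>N\<close> meets \<open>V - N\<close>, where by
      the choice of \<open>v\<close> no degree exceeds \<open>card N\<close>.\<close>
    have "E \<subseteq> (E \<inter> nsets N 2) \<union> (\<Union>u\<in>V - N. {e \<in> E. u \<in> e})"
      using Suc.prems(2) by (auto simp: nsets_def)
    then have "card E \<le> card ((E \<inter> nsets N 2) \<union> (\<Union>u\<in>V - N. {e \<in> E. u \<in> e}))"
      using finE Suc.prems(1) by (intro card_mono) auto
    also have "\<dots> \<le> card (E \<inter> nsets N 2) + card (\<Union>u\<in>V - N. {e \<in> E. u \<in> e})"
      by (rule card_Un_le)
    also have "card (\<Union>u\<in>V - N. {e \<in> E. u \<in> e}) \<le> (\<Sum>u\<in>V - N. deg u)"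
      unfolding deg_def using Suc.prems(1) by (intro card_UN_le) auto
    also have "\<dots> \<le> (\<Sum>u\<in>V - N. card N)"
      by (intro sum_mono) (use vmax degv in auto)
    also have "\<dots> = (card V - card N) * card N"
      using NV finN by (simp add: card_Diff_subset)
    finally have "real (card E) \<le> real (card (E \<inter> nsets N 2) + (card V - card N) * card N)"
      by linarith
    also have "\<dots> = real (card (E \<inter> nsets N 2)) + (real (card V) - real (card N)) * real (card N)"
      using card_mono[OF Suc.prems(1) NV] by (simp add: of_nat_diff)
    also have "\<dots> \<le> (1 - 1 / real w) * (real (card N))\<^sup>2 / 2
        + (real (card V) - real (card N)) * real (card N)"
      using IH by simp
    also have "\<dots> \<le> (1 - 1 / real (Suc w)) * (real (card V))\<^sup>2 / 2"
    proof -
      define x y z where "x = real (card N)" and "y = real (card V)" and "z = real w"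
      have z: "z \<ge> 1" using Suc.hyps by (simp add: z_def)
      \<comment> \<open>The right side minus the left side is a perfect square over a positive
        number. It vanishes at \<open>x = y * z / (z + 1)\<close>, the degree in the balanced
        complete multipartite graph.\<close>
      have "0 \<le> (x * (z + 1) - y * z)\<^sup>2 / (2 * z * (z + 1))"
        using z by simp
      also have "\<dots> = (x\<^sup>2 * (z + 1)\<^sup>2 - 2 * (x * y * (z * (z + 1))) + y\<^sup>2 * z\<^sup>2)
          / (2 * z * (z + 1))"
        by (simp add: power2_eq_square algebra_simps)
      also have "\<dots> = x\<^sup>2 * (z + 1) / (2 * z) - x * y + y\<^sup>2 * z / (2 * (z + 1))"
        using z by (simp add: divide_simps) (simp add: algebra_simps power2_eq_square)
      also have "\<dots> = (1 - 1 / (z + 1)) * y\<^sup>2 / 2 - ((1 - 1 / z) * x\<^sup>2 / 2 + (y - x) * x)"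
        using z by (simp add: divide_simps) (simp add: algebra_simps power2_eq_square)
      finally show ?thesis by (simp add: x_def y_def z_def add.commute)
    qed
    finally show ?thesis .
  qed
qed

text \<open>Double counting of pairs \<open>(v, S)\<close> where \<open>S\<close> is an
  \<open>s\<close>-subset of the neighbourhood of \<open>v\<close>. A dense graph has order
  \<open>n ^ (s + 1)\<close> such pairs, whereas without a complete bipartite subgraph there are
  only order \<open>n ^ s\<close>.\<close>

theorem kovari_sos_turan:
  fixes \<eta> :: real and s :: nat
  assumes "\<eta> > 0" "s \<ge> 1"
  shows "\<exists>n0. \<forall>(V :: 'a set) E. finite V \<longrightarrow> n0 \<le> card V \<longrightarrow> E \<subseteq> nsets V 2 \<longrightarrow>
    \<eta> * (real (card V))\<^sup>2 < real (card E) \<longrightarrow>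
    (\<exists>A B. A \<subseteq> V \<and> B \<subseteq> V \<and> A \<inter> B = {} \<and> card A = s \<and> card B = s \<and>
      (\<forall>a\<in>A. \<forall>b\<in>B. {a, b} \<in> E))"
proof -
  define g where "g = \<eta> / 2"
  have g: "g > 0" using assms by (simp add: g_def)
  \<comment> \<open>The first threshold contradicts the final inequality; the second makes
    \<open>g * n\<close> at least \<open>s\<close>, as the lower bound on the binomial coefficient
    requires.\<close>
  obtain n0 :: nat where n0: "real n0 > max (real s ^ (s + 1) / g ^ (s + 1)) (real s / g)"
    using reals_Archimedean2 by blast
  have "\<exists>A B. A \<subseteq> V \<and> B \<subseteq> V \<and> A \<inter> B = {} \<and> card A = s \<and> card B = s \<and>
      (\<forall>a\<in>A. \<forall>b\<in>B. {a, b} \<in> E)"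
    if V: "finite V" "n0 \<le> card V" and E: "E \<subseteq> nsets V 2"
      and dense: "\<eta> * (real (card V))\<^sup>2 < real (card E)" for V :: "'a set" and E
  proof (rule ccontr)
    assume neg: "\<not> ?thesis"
    define n where "n = card V"
    have ng: "real n > real s ^ (s + 1) / g ^ (s + 1)" "real n > real s / g"
      using n0 V(2) by (auto simp: n_def)
    then have n_pos: "real n > 0" using g
      by (meson divide_nonneg_pos le_less_trans of_nat_0_le_iff)
    define nb where "nb v = {u \<in> V. {v, u} \<in> E}" for v
    have nbV: "nb v \<subseteq> V" and fin_nb: "finite (nb v)" for v
      using V(1) by (auto simp: nb_def)
    have nb_n: "card (nb v) \<le> n" for v
      using card_mono[OF V(1) nbV] by (simp add: n_def)
    \<comment> \<open>Vertices outside \<open>L\<close> contribute at most \<open>g * n^2\<close> to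
      the degree sum, which exceeds \<open>2 * g * n^2\<close>, so \<open>L\<close> has more than
      \<open>g * n\<close> elements.\<close>
    define L where "L = {v \<in> V. g * real n \<le> real (card (nb v))}"
    have finL: "finite L" and LV: "L \<subseteq> V" using V(1) by (auto simp: L_def)
    have "E \<subseteq> (\<Union>v\<in>V. (\<lambda>u. {v, u}) ` nb v)"
    proof
      fix e assume e: "e \<in> E"
      then obtain x y where "e = {x, y}" "x \<in> V" "y \<in> V" using E by (blast elim: nsets2_E)
      with e show "e \<in> (\<Union>v\<in>V. (\<lambda>u. {v, u}) ` nb v)" by (auto simp: nb_def)
    qed
    then have "card E \<le> card (\<Union>v\<in>V. (\<lambda>u. {v, u}) ` nb v)"
      using V(1) fin_nb by (intro card_mono) auto
    also have "\<dots> \<le> (\<Sum>v\<in>V. card ((\<lambda>u. {v, u}) ` nb v))"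
      by (rule card_UN_le[OF V(1)])
    also have "\<dots> \<le> (\<Sum>v\<in>V. card (nb v))"
      by (intro sum_mono card_image_le fin_nb)
    finally have "real (card E) \<le> (\<Sum>v\<in>V. real (card (nb v)))"
      by (metis of_nat_le_iff of_nat_sum)
    also have "\<dots> = (\<Sum>v\<in>L. real (card (nb v))) + (\<Sum>v\<in>V - L. real (card (nb v)))"
      using sum.subset_diff[OF LV V(1)] by (simp add: add.commute)
    also have "\<dots> \<le> (\<Sum>v\<in>L. real n) + (\<Sum>v\<in>V - L. g * real n)"
      by (intro add_mono sum_mono) (auto simp: L_def nb_n)
    also have "\<dots> \<le> real (card L) * real n + real n * (g * real n)"
    proof -
      have "card (V - L) \<le> n" unfolding n_def by (intro card_mono V(1)) auto
      then show ?thesis using g by (simp add: mult_right_mono)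
    qed
    finally have "2 * g * real n * real n < real (card L) * real n + real n * (g * real n)"
      using dense by (simp add: g_def n_def power2_eq_square)
    then have "real n * (g * real n) < real n * real (card L)" by (simp add: algebra_simps)
    then have cardL: "g * real n < real (card L)" using n_pos by simp
    have sn: "real s \<le> g * real n" using ng(2) g by (simp add: field_simps)
    have lower: "(g * real n / real s) ^ s \<le> real (card (nb v) choose s)" if "v \<in> L" for v
    proof -
      have *: "g * real n \<le> real (card (nb v))" using that by (simp add: L_def)
      then have "s \<le> card (nb v)" using sn by linarith
      then have "(real (card (nb v)) / real s) ^ s \<le> real (card (nb v) choose s)"
        by (rule binomial_ge_n_over_k_pow_k)
      moreover have "(g * real n / real s) ^ s \<le> (real (card (nb v)) / real s) ^ s"
        using * g assms(2) by (intro power_mono divide_right_mono) auto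
      ultimately show ?thesis by linarith
    qed
    have "(\<Sum>v\<in>V. card {S \<in> nsets V s. S \<subseteq> nb v})
        = (\<Sum>S\<in>nsets V s. card {v \<in> V. S \<subseteq> nb v})"
      by (rule sum_multicount_gen) (use V(1) finite_imp_finite_nsets in auto)
    \<comment> \<open>An \<open>S\<close> with more than \<open>s\<close> common neighbours would
      form the forbidden bipartite graph with \<open>s\<close> of them.\<close>
    also have "\<dots> \<le> (\<Sum>S\<in>nsets V s. s)"
    proof (rule sum_mono)
      fix S assume S: "S \<in> nsets V s"
      show "card {v \<in> V. S \<subseteq> nb v} \<le> s"
      proof (rule ccontr)
        assume "\<not> ?thesis"
        then obtain A where A: "A \<subseteq> {v \<in> V. S \<subseteq> nb v}" "card A = s"
          by (meson obtain_subset_with_card_n nat_le_linear)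
        have "\<forall>a\<in>A. \<forall>b\<in>S. {a, b} \<in> E" using A by (auto simp: nb_def)
        moreover from this have "A \<inter> S = {}" using E by (auto simp: nsets_def) force
        moreover have "A \<subseteq> V" "S \<subseteq> V" "card S = s" using A S by (auto simp: nsets_def)
        ultimately show False using neg A(2) by blast
      qed
    qed
    also have "\<dots> = (n choose s) * s" by (simp add: n_def card_nsets)
    also have "\<dots> \<le> n ^ s * s"
      by (cases "s \<le> n") (auto simp: binomial_le_pow binomial_eq_0)
    finally have "(\<Sum>v\<in>V. card {S \<in> nsets V s. S \<subseteq> nb v}) \<le> n ^ s * s" .
    moreover have "{S \<in> nsets V s. S \<subseteq> nb v} = nsets (nb v) s" for v
      using nbV by (auto simp: nsets_def)
    ultimately have up: "(\<Sum>v\<in>V. card (nb v) choose s) \<le> n ^ s * s"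
      by (simp add: card_nsets)
    have "g * real n * (g * real n / real s) ^ s \<le> real (card L) * (g * real n / real s) ^ s"
      using cardL g n_pos by (intro mult_right_mono) auto
    also have "\<dots> = (\<Sum>v\<in>L. (g * real n / real s) ^ s)" by simp
    also have "\<dots> \<le> (\<Sum>v\<in>L. real (card (nb v) choose s))" by (intro sum_mono lower)
    also have "\<dots> \<le> (\<Sum>v\<in>V. real (card (nb v) choose s))"
      by (intro sum_mono2 V(1) LV) auto
    also have "\<dots> \<le> real (n ^ s * s)" using up by (metis of_nat_le_iff of_nat_sum)
    finally have "g * real n * (g * real n / real s) ^ s \<le> real n ^ s * real s" by simp
    then have "(g ^ (s + 1) * real n) * real n ^ s \<le> (real s ^ (s + 1)) * real n ^ s"
      using assms(2) by (simp add: field_simps power_mult_distrib power_divide)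
    then have "g ^ (s + 1) * real n \<le> real s ^ (s + 1)"
      using n_pos by simp
    moreover have "real s ^ (s + 1) < g ^ (s + 1) * real n"
      using ng(1) g by (simp add: pos_divide_less_eq mult.commute)
    ultimately show False by linarith
  qed
  then show ?thesis by blast
qed

subsection \<open>Reversing a prescribed graph\<close>

text \<open>
  A pair is reversed by a family of inversions iff it lies in an odd number of the sets, so \<open>E\<close>
  is the set of pairs reversed by at most \<open>t\<close> inversions.
\<close>

definition flips :: "'a set \<Rightarrow> nat \<Rightarrow> nat \<Rightarrow> 'a set set \<Rightarrow> bool" where
  "flips V k t E \<longleftrightarrow> (\<exists>F. F \<subseteq> Pow V \<and> card F \<le> t \<and> (\<forall>X\<in>F. card X \<le> k) \<and>
     (\<forall>e\<in>nsets V 2. odd (card {X \<in> F. e \<subseteq> X}) \<longleftrightarrow> e \<in> E))"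

lemma even_card_symdiff:
  assumes "finite A" "finite B"
  shows "even (card (A - B \<union> (B - A))) \<longleftrightarrow> (even (card A) \<longleftrightarrow> even (card B))"
proof -
  have "card (A - B \<union> (B - A)) = card (A - B) + card (B - A)"
    using assms by (intro card_Un_disjoint) auto
  moreover have "card A = card (A \<inter> B) + card (A - B)"
    using card_Int_Diff[OF assms(1)] .
  moreover have "card B = card (A \<inter> B) + card (B - A)"
    using card_Int_Diff[OF assms(2), of A] by (simp add: Int_commute)
  ultimately show ?thesis by auto
qed

lemma flips_mono: "flips V k t E \<Longrightarrow> t \<le> t' \<Longrightarrow> flips V k t' E"
  unfolding flips_def by (meson le_trans)

text \<open>Families are sets without multiplicities, so a set used by both sides must be dropped.
  Dropping it changes each count by two and leaves the parities unchanged.\<close>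

lemma flips_symdiff:
  assumes "finite V" "flips V k t E" "flips V k t' E'"
  shows "flips V k (t + t') (E - E' \<union> (E' - E))"
proof -
  obtain F where F: "F \<subseteq> Pow V" "card F \<le> t" "\<forall>X\<in>F. card X \<le> k"
    "\<And>e. e \<in> nsets V 2 \<Longrightarrow> odd (card {X \<in> F. e \<subseteq> X}) \<longleftrightarrow> e \<in> E"
    using assms(2) unfolding flips_def by blast
  obtain G where G: "G \<subseteq> Pow V" "card G \<le> t'" "\<forall>X\<in>G. card X \<le> k"
    "\<And>e. e \<in> nsets V 2 \<Longrightarrow> odd (card {X \<in> G. e \<subseteq> X}) \<longleftrightarrow> e \<in> E'"
    using assms(3) unfolding flips_def by blast
  have fin: "finite F" "finite G"
    using F(1) G(1) assms(1) by (auto intro: finite_subset)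
  define H where "H = F - G \<union> (G - F)"
  have "card H \<le> card F + card G"
    unfolding H_def using fin
    by (intro order_trans[OF card_Un_le] add_mono card_mono) auto
  then have "card H \<le> t + t'" using F(2) G(2) by linarith
  moreover have "odd (card {X \<in> H. e \<subseteq> X}) \<longleftrightarrow> e \<in> E - E' \<union> (E' - E)"
    if "e \<in> nsets V 2" for e
  proof -
    have "{X \<in> H. e \<subseteq> X} = {X \<in> F. e \<subseteq> X} - {X \<in> G. e \<subseteq> X}
        \<union> ({X \<in> G. e \<subseteq> X} - {X \<in> F. e \<subseteq> X})"
      by (auto simp: H_def)
    then show ?thesis
      using even_card_symdiff[of "{X \<in> F. e \<subseteq> X}" "{X \<in> G. e \<subseteq> X}"] fin F(4)[OF that] G(4)[OF that]
      by auto
  qed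
  moreover have "H \<subseteq> Pow V" "\<forall>X\<in>H. card X \<le> k"
    using F G by (auto simp: H_def)
  ultimately show ?thesis unfolding flips_def by blast
qed

lemma flips_union:
  assumes "finite V" "flips V k t E" "flips V k t' E'" "E \<inter> E' = {}"
  shows "flips V k (t + t') (E \<union> E')"
proof -
  have "E - E' \<union> (E' - E) = E \<union> E'" using assms(4) by blast
  then show ?thesis using flips_symdiff[OF assms(1-3)] by simp
qed

lemma flips_empty: "flips V k 0 {}"
  unfolding flips_def by (intro exI[of _ "{}"]) auto

lemma flips_clique:
  assumes "X \<subseteq> V" "card X \<le> k"
  shows "flips V k 1 (nsets X 2)"
proof -
  have "odd (card {Y \<in> {X}. e \<subseteq> Y}) \<longleftrightarrow> e \<in> nsets X 2" if "e \<in> nsets V 2" for e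
  proof -
    have "{Y \<in> {X}. e \<subseteq> Y} = (if e \<subseteq> X then {X} else {})" by auto
    then show ?thesis using that by (auto simp: nsets_def)
  qed
  then show ?thesis
    unfolding flips_def using assms by (intro exI[of _ "{X}"]) auto
qed

lemma flips_disjoint_cliques:
  assumes "finite V" "finite P" "\<And>X. X \<in> P \<Longrightarrow> X \<subseteq> V \<and> card X \<le> k"
    and "\<And>X Y. X \<in> P \<Longrightarrow> Y \<in> P \<Longrightarrow> X \<noteq> Y \<Longrightarrow> nsets X 2 \<inter> nsets Y 2 = {}"
  shows "flips V k (card P) (\<Union>X\<in>P. nsets X 2)"
  using assms(2-4)
proof (induction P rule: finite_induct)
  case empty
  show ?case by (simp add: flips_empty)
next
  case (insert X P)
  have "flips V k (1 + card P) (nsets X 2 \<union> (\<Union>Y\<in>P. nsets Y 2))"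
  proof (rule flips_union[OF assms(1)])
    show "flips V k 1 (nsets X 2)" using insert.prems(1) by (intro flips_clique) auto
    show "flips V k (card P) (\<Union>Y\<in>P. nsets Y 2)"
      by (rule insert.IH) (use insert.prems in auto)
    show "nsets X 2 \<inter> (\<Union>Y\<in>P. nsets Y 2) = {}"
      using insert.prems(2)[of X] insert.hyps by blast
  qed
  then show ?case using insert.hyps by simp
qed

lemma flips_edges:
  assumes "finite V" "E \<subseteq> nsets V 2" "k \<ge> 2"
  shows "flips V k (card E) E"
proof -
  have eq: "nsets e 2 = {e}" if "e \<in> E" for e
  proof -
    have "e \<in> nsets V 2" using that assms(2) by blast
    then show ?thesis by (auto elim!: nsets2_E)
  qed
  have "flips V k (card E) (\<Union>e\<in>E. nsets e 2)"
  proof (rule flips_disjoint_cliques[OF assms(1)])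
    show "finite E" using assms finite_imp_finite_nsets finite_subset by metis
    show "e \<subseteq> V \<and> card e \<le> k" if "e \<in> E" for e
      using that assms(2,3) by (auto simp: nsets_def)
  qed (simp add: eq)
  moreover have "(\<Union>e\<in>E. nsets e 2) = E" using eq by auto
  ultimately show ?thesis by simp
qed

definition complete_bipartite :: "'a set \<Rightarrow> 'a set \<Rightarrow> 'a set set" where
  "complete_bipartite A B = {{x, y} | x y. x \<in> A \<and> y \<in> B}"

lemma card_complete_bipartite:
  assumes "A \<inter> B = {}"
  shows "card (complete_bipartite A B) = card A * card B"
proof -
  have "complete_bipartite A B = (\<lambda>(x, y). {x, y}) ` (A \<times> B)" by (auto simp: complete_bipartite_def)
  moreover have "inj_on (\<lambda>(x, y). {x, y}) (A \<times> B)"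
    using assms by (auto simp: inj_on_def doubleton_eq_iff)
  ultimately show ?thesis by (simp add: card_image card_cartesian_product)
qed

text \<open>
  The four sets consist of one half of \<open>A\<close> and one half of \<open>B\<close> each, so that the pairs inside
  a half are flipped twice.
\<close>

lemma flips_complete_bipartite:
  assumes "finite V" "A \<subseteq> V" "B \<subseteq> V" "A \<inter> B = {}" "card A = 2 * a" "card B = 2 * b" "a + b \<le> k"
  shows "flips V k 4 (complete_bipartite A B)"
proof -
  have fin: "finite A" "finite B" using assms by (auto intro: finite_subset)
  obtain A1 where A1: "A1 \<subseteq> A" "card A1 = a"
    using assms(5) by (metis obtain_subset_with_card_n le_add1 mult_2)
  obtain B1 where B1: "B1 \<subseteq> B" "card B1 = b"
    using assms(6) by (metis obtain_subset_with_card_n le_add1 mult_2)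
  define A2 where "A2 = A - A1"
  define B2 where "B2 = B - B1"
  have c2: "card A2 = a" "card B2 = b"
    using A1 B1 fin assms(5,6) by (auto simp: A2_def B2_def card_Diff_subset finite_subset)
  have un: "A = A1 \<union> A2" "B = B1 \<union> B2" "A1 \<inter> A2 = {}" "B1 \<inter> B2 = {}"
    using A1 B1 by (auto simp: A2_def B2_def)
  have fl: "flips V k 1 (nsets (S \<union> S') 2)"
    if "S \<in> {A1, A2}" "S' \<in> {B1, B2}" for S S'
  proof (rule flips_clique)
    show "S \<union> S' \<subseteq> V" using that un assms(2,3) by auto
    have "card (S \<union> S') \<le> card S + card S'" by (rule card_Un_le)
    also have "\<dots> = a + b" using that A1 B1 c2 by auto
    finally show "card (S \<union> S') \<le> k" using assms(7) by linarith
  qed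
  define sd :: "'a set set \<Rightarrow> 'a set set \<Rightarrow> 'a set set" where "sd X Y = X - Y \<union> (Y - X)" for X Y
  have "flips V k ((1 + 1) + (1 + 1))
     (sd (sd (nsets (A1 \<union> B1) 2) (nsets (A1 \<union> B2) 2))
         (sd (nsets (A2 \<union> B1) 2) (nsets (A2 \<union> B2) 2)))"
    unfolding sd_def by (intro flips_symdiff assms(1) fl) auto
  \<comment> \<open>A pair across \<open>A\<close> and \<open>B\<close> lies in exactly one of the
    four sets, a pair inside a half in two, and a pair joining the two halves of one side in
    none.\<close>
  moreover have "sd (sd (nsets (A1 \<union> B1) 2) (nsets (A1 \<union> B2) 2))
         (sd (nsets (A2 \<union> B1) 2) (nsets (A2 \<union> B2) 2)) = complete_bipartite A B" (is "?S = _")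
  proof (rule set_eqI)
    fix e
    show "e \<in> ?S \<longleftrightarrow> e \<in> complete_bipartite A B"
    proof (cases "\<exists>x y. e = {x, y} \<and> x \<noteq> y")
      case True
      then obtain x y where e: "e = {x, y}" "x \<noteq> y" by blast
      have "e \<in> complete_bipartite A B \<longleftrightarrow> (x \<in> A \<and> y \<in> B) \<or> (y \<in> A \<and> x \<in> B)"
        by (auto simp: complete_bipartite_def e doubleton_eq_iff)
      moreover have excl: "z \<in> A1 \<Longrightarrow> z \<notin> A2 \<and> z \<notin> B1 \<and> z \<notin> B2"
        "z \<in> A2 \<Longrightarrow> z \<notin> B1 \<and> z \<notin> B2" "z \<in> B1 \<Longrightarrow> z \<notin> B2" for z
        using un assms(4) by blast+
      ultimately show ?thesis
        using e(2) excl[of x] excl[of y]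
        unfolding sd_def e(1) un(1,2) Diff_iff Un_iff doubleton_in_nsets_2 by argo
    next
      case False
      then have "e \<notin> nsets S 2" for S :: "'a set" by (blast elim: nsets2_E)
      moreover have "e \<notin> complete_bipartite A B" using False assms(4) unfolding complete_bipartite_def by blast
      ultimately show ?thesis by (auto simp: sd_def)
    qed
  qed
  ultimately show ?thesis using flips_mono[of V k "(1 + 1) + (1 + 1)" _ 4] by simp
qed

text \<open>Greedy removal. While more than \<open>\<eta> * n^2\<close> edges remain, there is a
  complete bipartite graph with \<open>4 * a * b\<close> edges, removed by four sets at a cost of
  \<open>1 / (a * b)\<close> per edge. The sparse remainder is reversed edge by edge.\<close>

theorem flips_asymptotic:
  fixes \<eta> :: real
  assumes "\<eta> > 0" "a \<ge> 1" "b \<ge> 1" "a + b \<le> k"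
  shows "\<exists>n0. \<forall>(V :: 'a set) E. finite V \<longrightarrow> n0 \<le> card V \<longrightarrow> E \<subseteq> nsets V 2 \<longrightarrow>
    (\<exists>t. flips V k t E \<and> real t \<le> real (card E) / real (a * b) + \<eta> * (real (card V))\<^sup>2)"
proof -
  \<comment> \<open>Sides of size \<open>2 * (a + b)\<close> contain subsets of the unequal sizes
    \<open>2 * a\<close> and \<open>2 * b\<close>.\<close>
  have "1 \<le> 2 * (a + b)" using assms(2) by simp
  from kovari_sos_turan[OF assms(1) this] obtain n0 where n0: "\<forall>(V :: 'a set) E. finite V \<longrightarrow>
    n0 \<le> card V \<longrightarrow> E \<subseteq> nsets V 2 \<longrightarrow> \<eta> * (real (card V))\<^sup>2 < real (card E) \<longrightarrow>
    (\<exists>A B. A \<subseteq> V \<and> B \<subseteq> V \<and> A \<inter> B = {} \<and> card A = 2 * (a + b) \<and> card B = 2 * (a + b) \<and>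
      (\<forall>a\<in>A. \<forall>b\<in>B. {a, b} \<in> E))" ..
  have "\<exists>t. flips V k t E \<and> real t \<le> real (card E) / real (a * b) + \<eta> * (real (card V))\<^sup>2"
    if V: "finite V" "n0 \<le> card V" and "E \<subseteq> nsets V 2" for V :: "'a set" and E
    using that(3)
  proof (induction "card E" arbitrary: E rule: less_induct)
    case less
    have finE: "finite E"
      using less.prems V(1) finite_imp_finite_nsets finite_subset by metis
    show ?case
    proof (cases "\<eta> * (real (card V))\<^sup>2 < real (card E)")
      case False
      have "flips V k (card E) E"
        using assms by (intro flips_edges V(1) less.prems) auto
      moreover have "0 \<le> real (card E) / real (a * b)" by simp
      ultimately show ?thesis using False by (intro exI[of _ "card E"]) linarith
    next
      case True
      obtain A' B' where AB': "A' \<subseteq> V" "B' \<subseteq> V" "A' \<inter> B' = {}" "card A' = 2 * (a + b)"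
        "card B' = 2 * (a + b)" "\<forall>a\<in>A'. \<forall>b\<in>B'. {a, b} \<in> E"
        using n0[rule_format, OF V less.prems True] by blast
      have "2 * a \<le> card A'" "2 * b \<le> card B'" using AB' by simp_all
      then obtain A B where A: "A \<subseteq> A'" "card A = 2 * a" and B: "B \<subseteq> B'" "card B = 2 * b"
        by (meson obtain_subset_with_card_n)
      have disj: "A \<inter> B = {}" using A B AB' by blast
      have sub: "complete_bipartite A B \<subseteq> E" using A(1) B(1) AB'(6) unfolding complete_bipartite_def by blast
      have c: "card (complete_bipartite A B) = 4 * (a * b)"
        using card_complete_bipartite[OF disj] A B by simp
      have c': "card (E - complete_bipartite A B) + 4 * (a * b) = card E"
        using c sub finE by (metis card_Diff_subset card_mono finite_subset le_add_diff_inverse2)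
      have "0 < a * b" using assms by simp
      then have "card (E - complete_bipartite A B) < card E" using c' by linarith
      moreover have "E - complete_bipartite A B \<subseteq> nsets V 2" using less.prems by blast
      ultimately obtain t where t: "flips V k t (E - complete_bipartite A B)"
        "real t \<le> real (card (E - complete_bipartite A B)) / real (a * b) + \<eta> * (real (card V))\<^sup>2"
        using less.hyps by blast
      have "flips V k 4 (complete_bipartite A B)"
        by (rule flips_complete_bipartite[OF V(1) _ _ disj A(2) B(2) assms(4)]) (use A B AB' in auto)
      then have "flips V k (4 + t) (complete_bipartite A B \<union> (E - complete_bipartite A B))"
        by (intro flips_union V(1) t) auto
      moreover have "complete_bipartite A B \<union> (E - complete_bipartite A B) = E" using sub by blast
      moreover have "real (4 + t) \<le> real (card E) / real (a * b) + \<eta> * (real (card V))\<^sup>2"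
      proof -
        have "real (card E) = real (card (E - complete_bipartite A B)) + 4 * real (a * b)"
          using c' by (metis of_nat_add of_nat_mult of_nat_numeral)
        moreover have "real (a * b) > 0" using assms by simp
        ultimately have "real (card E) / real (a * b) = real (card (E - complete_bipartite A B)) / real (a * b) + 4"
          by (simp add: add_divide_distrib del: of_nat_mult)
        then show ?thesis using t(2) by simp
      qed
      ultimately show ?thesis by metis
    qed
  qed
  then show ?thesis by blast
qed

subsection \<open>Tournaments\<close>

definition tournament_on :: "'a set \<Rightarrow> ('a \<times> 'a) set \<Rightarrow> bool" where
  "tournament_on V T \<longleftrightarrow> T \<subseteq> V \<times> V \<and> (\<forall>u v. (u, v) \<in> T \<longrightarrow> (v, u) \<notin> T) \<and>
     (\<forall>u\<in>V. \<forall>v\<in>V. u \<noteq> v \<longrightarrow> (u, v) \<in> T \<or> (v, u) \<in> T)"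

text \<open>Orders are given by integer-valued maps so that negation yields the opposite
  order.\<close>

definition back_edges :: "('a \<times> 'a) set \<Rightarrow> ('a \<Rightarrow> int) \<Rightarrow> 'a set set" where
  "back_edges T f = {{u, v} | u v. (u, v) \<in> T \<and> f v < f u}"

lemma back_edges_iff:
  assumes "tournament_on V T" "(u, v) \<in> T"
  shows "{u, v} \<in> back_edges T f \<longleftrightarrow> f v < f u"
  using assms by (auto simp: back_edges_def tournament_on_def doubleton_eq_iff)

lemma back_edges_sub:
  assumes "tournament_on V T"
  shows "back_edges T f \<subseteq> nsets V 2"
  using assms by (fastforce simp: back_edges_def tournament_on_def)

text \<open>Each pair is backward under exactly one of two opposite orders. The upper bound averages
  over such a couple of orders.\<close>

lemma card_back_edges_reverse:
  assumes "tournament_on V T" "finite V" "inj_on f V"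
  shows "card (back_edges T f) + card (back_edges T (\<lambda>v. - f v)) = card V choose 2"
proof -
  have sub: "back_edges T f \<subseteq> nsets V 2" "back_edges T (\<lambda>v. - f v) \<subseteq> nsets V 2"
    using back_edges_sub[OF assms(1)] by blast+
  have "back_edges T f \<union> back_edges T (\<lambda>v. - f v) = nsets V 2"
  proof
    show "nsets V 2 \<subseteq> back_edges T f \<union> back_edges T (\<lambda>v. - f v)"
    proof
      fix e assume "e \<in> nsets V 2"
      then obtain x y where xy: "e = {x, y}" "x \<in> V" "y \<in> V" "x \<noteq> y" by (rule nsets2_E)
      then have "f x \<noteq> f y" using assms(3) by (auto dest: inj_onD)
      moreover have "(x, y) \<in> T \<or> (y, x) \<in> T" using assms(1) xy by (auto simp: tournament_on_def)
      ultimately show "e \<in> back_edges T f \<union> back_edges T (\<lambda>v. - f v)"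
        using back_edges_iff[OF assms(1), of x y] back_edges_iff[OF assms(1), of y x] xy(1)
        by (auto simp: insert_commute)
    qed
  qed (use sub in blast)
  moreover have "back_edges T f \<inter> back_edges T (\<lambda>v. - f v) = {}"
    using assms(1) by (auto simp: back_edges_def tournament_on_def doubleton_eq_iff)
  moreover have "finite (nsets V 2)" using assms(2) by (rule finite_imp_finite_nsets)
  ultimately show ?thesis
    using sub card_Un_disjoint[of "back_edges T f" "back_edges T (\<lambda>v. - f v)"]
    by (simp add: card_nsets finite_subset)
qed

section \<open>Transitive subtournaments and their packings\<close>

lemma tournament_on_subset:
  assumes "tournament_on V T" "W \<subseteq> V"
  shows "tournament_on W (T \<inter> W \<times> W)"
  using assms unfolding tournament_on_def by blast

text \<open>One of the out- and in-neighbourhood of any vertex retains at least \<open>2 ^ k\<close>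
  vertices; the vertex is placed before or after the list found there.\<close>

lemma transitive_subtournament:
  assumes "tournament_on V T" "finite V" "2 ^ k \<le> card V"
  shows "\<exists>xs. set xs \<subseteq> V \<and> length xs = k \<and> sorted_wrt (\<lambda>u v. (u, v) \<in> T) xs"
  using assms
proof (induction k arbitrary: V T)
  case 0
  show ?case by (intro exI[of _ "[]"]) simp
next
  case (Suc k)
  have "V \<noteq> {}" using Suc.prems(3) by auto
  then obtain v where v: "v \<in> V" by blast
  define X where "X = {u \<in> V. (v, u) \<in> T}"
  define Y where "Y = {u \<in> V. (u, v) \<in> T}"
  have fin: "finite X" "finite Y" and sub: "X \<subseteq> V" "Y \<subseteq> V"
    using Suc.prems(2) by (auto simp: X_def Y_def)
  have "V = insert v (X \<union> Y)"
    using Suc.prems(1) v by (auto simp: X_def Y_def tournament_on_def)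
  then have "card V \<le> Suc (card (X \<union> Y))" using fin by (metis card_insert_le_m1 card_insert_if finite_UnI le_SucI order_refl)
  also have "\<dots> \<le> Suc (card X + card Y)" using card_Un_le by auto
  finally have "2 ^ k \<le> card X \<or> 2 ^ k \<le> card Y" using Suc.prems(3) by auto
  then show ?case
  proof
    assume "2 ^ k \<le> card X"
    then obtain xs where "set xs \<subseteq> X" "length xs = k" "sorted_wrt (\<lambda>u v. (u, v) \<in> T \<inter> X \<times> X) xs"
      using Suc.IH[OF tournament_on_subset[OF Suc.prems(1) sub(1)] fin(1)] by blast
    then show ?thesis
      using v by (intro exI[of _ "v # xs"]) (auto simp: X_def intro: sorted_wrt_mono_rel[rotated])
  next
    assume "2 ^ k \<le> card Y"
    then obtain xs where "set xs \<subseteq> Y" "length xs = k" "sorted_wrt (\<lambda>u v. (u, v) \<in> T \<inter> Y \<times> Y) xs"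
      using Suc.IH[OF tournament_on_subset[OF Suc.prems(1) sub(2)] fin(2)] by blast
    then show ?thesis
      using v by (intro exI[of _ "xs @ [v]"])
        (auto simp: Y_def sorted_wrt_append intro: sorted_wrt_mono_rel[rotated])
  qed
qed

text \<open>For a tournament, \<open>g\<close> numbers \<open>X\<close> from sink to source, so
  every pair in \<open>X\<close> is backward under \<open>g\<close>. The range \<open>{..<k}\<close>
  allows ranks to serve as colours and makes the rank functions countable in a union bound.\<close>

definition transitive_set :: "('a \<times> 'a) set \<Rightarrow> nat \<Rightarrow> 'a set \<Rightarrow> bool" where
  "transitive_set T k X \<longleftrightarrow> finite X \<and> card X = k \<and>
     (\<exists>g. g ` X \<subseteq> {..<k} \<and> (\<forall>u\<in>X. \<forall>v\<in>X. (u, v) \<in> T \<longrightarrow> g v < g u))"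

lemma transitive_set_of_list:
  assumes "tournament_on V T" "sorted_wrt (\<lambda>u v. (u, v) \<in> T) xs"
  shows "transitive_set T (length xs) (set xs)"
proof -
  have irr: "(u, u) \<notin> T" and asy: "(u, v) \<in> T \<Longrightarrow> (v, u) \<notin> T" for u v
    using assms(1) by (auto simp: tournament_on_def)
  have "distinct xs" using assms(2) irr by (induction xs) auto
  moreover have "\<exists>g. g ` set xs \<subseteq> {..<length xs} \<and>
     (\<forall>u\<in>set xs. \<forall>v\<in>set xs. (u, v) \<in> T \<longrightarrow> g v < g u)"
    using assms(2)
  proof (induction xs)
    case (Cons x xs)
    then obtain g where g: "g ` set xs \<subseteq> {..<length xs}"
      "\<forall>u\<in>set xs. \<forall>v\<in>set xs. (u, v) \<in> T \<longrightarrow> g v < g u" by auto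
    have x: "\<forall>y\<in>set xs. (x, y) \<in> T" using Cons.prems by simp
    then have xn: "x \<notin> set xs" using irr by blast
    \<comment> \<open>Ranks count from the end of the list, so the new head, which has arcs to all
      of \<open>xs\<close>, receives the top rank.\<close>
    have "(g(x := length xs)) ` set (x # xs) \<subseteq> {..<length (x # xs)}"
      using g(1) by auto
    moreover have "\<forall>u\<in>set (x # xs). \<forall>v\<in>set (x # xs). (u, v) \<in> T \<longrightarrow>
        (g(x := length xs)) v < (g(x := length xs)) u"
      using g x irr asy by auto
    ultimately show ?case by blast
  qed simp
  ultimately show ?thesis by (simp add: transitive_set_def distinct_card)
qed

lemma real_choose_two: "real (n choose 2) = real n * (real n - 1) / 2"
proof -
  have "even (n * (n - 1))" by (cases n) auto
  then have "real (n choose 2) = real (n * (n - 1)) / 2"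
    by (simp only: choose_two real_of_nat_div of_nat_numeral)
  then show ?thesis by (cases n) (auto simp: algebra_simps)
qed

text \<open>Take a maximal edge-disjoint family. The uncovered pairs contain no clique on
  \<open>2 ^ k + 1\<close> vertices, because such a clique would contain a further transitive
  \<open>k\<close>-set, so Turan's bound leaves a fraction \<open>1 / 2 ^ k\<close> of the pairs to
  be covered.\<close>

lemma transitive_packing:
  assumes T: "tournament_on V T" and V: "finite V" and k: "k \<ge> 2"
  obtains P where "finite P" "\<And>X. X \<in> P \<Longrightarrow> X \<subseteq> V \<and> transitive_set T k X"
    "\<And>X Y. X \<in> P \<Longrightarrow> Y \<in> P \<Longrightarrow> X \<noteq> Y \<Longrightarrow> nsets X 2 \<inter> nsets Y 2 = {}"
    "(real (card V))\<^sup>2 / (2 * 2 ^ k) - real (card V) / 2 \<le> real (k choose 2) * real (card P)"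
proof -
  define good where "good P \<longleftrightarrow> P \<subseteq> Pow V \<and> (\<forall>X\<in>P. transitive_set T k X) \<and>
      (\<forall>X\<in>P. \<forall>Y\<in>P. X \<noteq> Y \<longrightarrow> nsets X 2 \<inter> nsets Y 2 = {})" for P
  have "Collect good \<subseteq> Pow (Pow V)" unfolding good_def by blast
  then have "finite (Collect good)" using V by (simp add: finite_subset)
  moreover have "{} \<in> Collect good" by (simp add: good_def)
  ultimately obtain P where P: "good P" and Pmax: "\<And>Q. good Q \<Longrightarrow> P \<subseteq> Q \<Longrightarrow> P = Q"
    using finite_has_maximal[of "Collect good"] by blast
  have finP: "finite P" using P V by (auto simp: good_def intro: finite_subset)
  define E where "E = nsets V 2 - (\<Union>X\<in>P. nsets X 2)"
  have "real (card E) \<le> (1 - 1 / real (2 ^ k)) * (real (card V))\<^sup>2 / 2"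
  proof (rule turan_bound[OF _ V])
    fix C assume C: "C \<subseteq> V" "card C = Suc (2 ^ k)"
    show "\<not> nsets C 2 \<subseteq> E"
    proof
      assume CE: "nsets C 2 \<subseteq> E"
      have finC: "finite C" using C(1) V finite_subset by blast
      have TC: "tournament_on C (T \<inter> C \<times> C)" using T C(1) by (rule tournament_on_subset)
      obtain xs where xs: "set xs \<subseteq> C" "length xs = k" "sorted_wrt (\<lambda>u v. (u, v) \<in> T \<inter> C \<times> C) xs"
        using transitive_subtournament[OF TC finC, of k] C(2) by auto
      have tr: "transitive_set T k (set xs)"
        using transitive_set_of_list[OF T, of xs] xs(2) sorted_wrt_mono_rel[OF _ xs(3)] by auto
      have disj: "nsets (set xs) 2 \<inter> nsets X 2 = {}" if "X \<in> P" for X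
        using CE nsets_mono[OF xs(1), of 2] that by (auto simp: E_def)
      have "good (insert (set xs) P)"
        using P tr disj xs(1) C(1) unfolding good_def by (auto simp: Int_commute)
      \<comment> \<open>By maximality the new set already belongs to \<open>P\<close>, so it shares
        no pair with itself; but \<open>k \<ge> 2\<close> gives it a pair.\<close>
      then have mem: "set xs \<in> P" using Pmax by blast
      have "nsets (set xs) 2 = {}" using disj[OF mem] by simp
      then show False using tr k by (simp add: nsets_eq_empty_iff transitive_set_def)
    qed
  qed (auto simp: E_def)
  moreover have "card (nsets V 2) \<le> card E + (k choose 2) * card P"
  proof -
    have "card (nsets V 2) \<le> card (E \<union> (\<Union>X\<in>P. nsets X 2))"
      using P V finP by (intro card_mono) (auto simp: E_def good_def transitive_set_def finite_imp_finite_nsets)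
    also have "\<dots> \<le> card E + card (\<Union>X\<in>P. nsets X 2)" by (rule card_Un_le)
    also have "card (\<Union>X\<in>P. nsets X 2) \<le> (\<Sum>X\<in>P. card (nsets X 2))"
      by (rule card_UN_le[OF finP])
    also have "\<dots> = (\<Sum>X\<in>P. k choose 2)"
      using P by (intro sum.cong refl) (auto simp: good_def transitive_set_def card_nsets)
    finally show ?thesis by (simp add: mult.commute)
  qed
  then have "real (card V choose 2) \<le> real (card E) + real (k choose 2) * real (card P)"
    unfolding card_nsets by (metis of_nat_add of_nat_le_iff of_nat_mult)
  ultimately have "(real (card V))\<^sup>2 / (2 * 2 ^ k) - real (card V) / 2 \<le> real (k choose 2) * real (card P)"
    by (simp add: real_choose_two[of "card V"] power2_eq_square left_diff_distrib right_diff_distrib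
        diff_divide_distrib)
  then show thesis
    using that[OF finP] P by (auto simp: good_def)
qed

subsection \<open>The upper bound\<close>

text \<open>
  Colour the vertices with \<open>k\<close> colours and order them primarily by colour. A transitive \<open>k\<close>-set is
  reversed by this order if its colours are its ranks, which holds for a fraction of \<open>1 / k ^ k\<close>
  of all colourings.
\<close>

lemma separating_order:
  fixes V :: "'a set"
  assumes T: "tournament_on V T" and V: "finite V" and k: "k \<ge> 1"
    and P: "finite P" "\<And>X. X \<in> P \<Longrightarrow> X \<subseteq> V \<and> transitive_set T k X"
  obtains f :: "'a \<Rightarrow> int" and Q where "inj_on f V" "Q \<subseteq> P" "card P \<le> card Q * k ^ k"
    "\<And>X. X \<in> Q \<Longrightarrow> nsets X 2 \<subseteq> back_edges T f"
proof -
  have "\<forall>X\<in>P. \<exists>g. g ` X \<subseteq> {..<k} \<and> (\<forall>u\<in>X. \<forall>v\<in>X. (u, v) \<in> T \<longrightarrow> g v < g u)"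
    using P(2) by (auto simp: transitive_set_def)
  then obtain g where g: "\<And>X. X \<in> P \<Longrightarrow> g X ` X \<subseteq> {..<k}"
    "\<And>X u v. X \<in> P \<Longrightarrow> u \<in> X \<Longrightarrow> v \<in> X \<Longrightarrow> (u, v) \<in> T \<Longrightarrow> g X v < g X u"
    by metis
  define C where "C = V \<rightarrow>\<^sub>E {..<k}"
  define Q where "Q c = {X \<in> P. \<forall>v\<in>X. c v = g X v}" for c
  have finC: "finite C" unfolding C_def using V by (intro finite_PiE) auto
  have cardC: "card C = k ^ card V" using V by (simp add: C_def card_PiE)
  \<comment> \<open>Prescribing the colours on \<open>X\<close> leaves exactly the
    \<open>card V - k\<close> other vertices free; the product form avoids division.\<close>
  have agree: "card {c \<in> C. \<forall>v\<in>X. c v = g X v} * k ^ k = k ^ card V" if X: "X \<in> P" for X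
  proof -
    have XV: "X \<subseteq> V" and cX: "card X = k" "finite X"
      using P(2)[OF X] by (auto simp: transitive_set_def)
    have "{c \<in> C. \<forall>v\<in>X. c v = g X v} = (\<Pi>\<^sub>E v\<in>V. if v \<in> X then {g X v} else {..<k})"
    (is "_ = ?P")
    proof (intro equalityI subsetI)
      fix c assume c: "c \<in> ?P"
      then have c': "c v \<in> (if v \<in> X then {g X v} else {..<k})" if "v \<in> V" for v
        using that by (rule PiE_mem)
      have "c v = g X v" if "v \<in> X" for v using c'[of v] that XV by auto
      moreover have "c v < k" if "v \<in> V" for v
        using c'[OF that] g(1)[OF X] by (cases "v \<in> X") auto
      ultimately show "c \<in> {c \<in> C. \<forall>v\<in>X. c v = g X v}"
        using c by (auto simp: C_def PiE_iff)
    qed (auto simp: C_def PiE_iff)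
    then have "card {c \<in> C. \<forall>v\<in>X. c v = g X v} = (\<Prod>v\<in>V. if v \<in> X then 1 else k)"
      using V by (simp add: card_PiE if_distrib cong: if_cong)
    also have "\<dots> = (\<Prod>v\<in>V - X. k)"
      using V by (intro prod.mono_neutral_cong_right) auto
    also have "\<dots> = k ^ (card V - k)" using XV cX by (simp add: card_Diff_subset)
    finally show ?thesis
      using card_mono[OF V XV] cX by (simp flip: power_add)
  qed
  \<comment> \<open>Averaging: if all colourings fell short, counting the pairs
    \<open>(c, X)\<close> in which \<open>c\<close> agrees with the ranks on \<open>X\<close> in two
    ways would contradict \<open>agree\<close>.\<close>
  have "\<exists>c\<in>C. card P \<le> card (Q c) * k ^ k"
  proof (rule ccontr)
    assume "\<not> ?thesis"
    then have less: "\<And>c. c \<in> C \<Longrightarrow> card (Q c) * k ^ k < card P" by (meson not_le)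
    have "C \<noteq> {}" using cardC k by (metis card.empty not_one_le_zero power_eq_0_iff)
    then have "(\<Sum>c\<in>C. card (Q c) * k ^ k) < (\<Sum>c\<in>C. card P)"
      by (intro sum_strict_mono finC less)
    also have "\<dots> = (\<Sum>X\<in>P. k ^ card V)" by (simp add: cardC)
    also have "\<dots> = (\<Sum>X\<in>P. card {c \<in> C. \<forall>v\<in>X. c v = g X v} * k ^ k)"
      by (intro sum.cong refl) (simp add: agree)
    also have "\<dots> = (\<Sum>X\<in>P. card {c \<in> C. \<forall>v\<in>X. c v = g X v}) * k ^ k"
      by (simp add: sum_distrib_right)
    also have "(\<Sum>X\<in>P. card {c \<in> C. \<forall>v\<in>X. c v = g X v}) = (\<Sum>c\<in>C. card (Q c))"
      unfolding Q_def by (rule sum_multicount_gen[symmetric]) (use finC P(1) in auto)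
    finally show False by (simp add: sum_distrib_right)
  qed
  then obtain c where c: "c \<in> C" "card P \<le> card (Q c) * k ^ k" by blast
  obtain idx :: "'a \<Rightarrow> nat" and M where idx: "idx ` V = {i. i < M}" "inj_on idx V"
    using finite_imp_inj_to_nat_seg[OF V] by blast
  have idxM: "idx v < M" if "v \<in> V" for v using idx(1) that by blast
  \<comment> \<open>Lexicographic order: since \<open>idx v < M\<close>, the colour dominates and
    \<open>idx\<close> only breaks ties.\<close>
  define f where "f v = int (c v * M + idx v)" for v
  have "inj_on f V"
  proof (rule inj_onI)
    fix u v assume uv: "u \<in> V" "v \<in> V" "f u = f v"
    then have "c u * M + idx u = c v * M + idx v" by (simp only: f_def of_nat_eq_iff)
    then have "(c u * M + idx u) mod M = (c v * M + idx v) mod M" by simp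
    then have "idx u = idx v" using idxM uv by simp
    then show "u = v" using idx(2) uv by (auto dest: inj_onD)
  qed
  moreover have "nsets X 2 \<subseteq> back_edges T f" if X: "X \<in> Q c" for X
  proof
    have XP: "X \<in> P" and cg: "\<And>v. v \<in> X \<Longrightarrow> c v = g X v" using X by (auto simp: Q_def)
    have XV: "X \<subseteq> V" using P(2)[OF XP] by blast
    have less: "f v < f u" if uv: "u \<in> X" "v \<in> X" "(u, v) \<in> T" for u v
    proof -
      have "Suc (c v) \<le> c u" using g(2)[OF XP uv] cg uv by simp
      then have "Suc (c v) * M \<le> c u * M" by (rule mult_right_mono) simp
      then have "c v * M + idx v < c u * M + idx u"
        using idxM[of v] uv XV by auto
      then show ?thesis by (simp only: f_def of_nat_less_iff)
    qed
    fix e assume "e \<in> nsets X 2"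
    then obtain x y where xy: "e = {x, y}" "x \<in> X" "y \<in> X" "x \<noteq> y" by (rule nsets2_E)
    then have "(x, y) \<in> T \<or> (y, x) \<in> T" using T XV unfolding tournament_on_def by blast
    then show "e \<in> back_edges T f"
      using xy less by (auto simp: back_edges_def)
  qed
  moreover have "Q c \<subseteq> P" by (auto simp: Q_def)
  ultimately show thesis using that c(2) by blast
qed

text \<open>Identifies the constant of the upper bound with the largest product \<open>a * b\<close>
  subject to \<open>a + b = k\<close>.\<close>

lemma floor_half_square: "\<lfloor>(real k)\<^sup>2 / 2\<rfloor> = int (2 * ((k div 2) * (k - k div 2)))"
proof (cases "even k")
  case True
  then obtain j where k: "k = 2 * j" by (rule evenE)
  have "(real k)\<^sup>2 / 2 = real_of_int (int (2 * (j * j)))"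
    unfolding k by (simp add: power2_eq_square)
  then have "\<lfloor>(real k)\<^sup>2 / 2\<rfloor> = int (2 * (j * j))"
    by (simp only: floor_of_int)
  moreover have "k div 2 = j" "k - k div 2 = j" using k by auto
  ultimately show ?thesis by simp
next
  case False
  then obtain j where k: "k = 2 * j + 1" by (rule oddE)
  have "(real k)\<^sup>2 / 2 = real_of_int (int (2 * (j * (j + 1)))) + 1 / 2"
    unfolding k by (simp add: power2_eq_square algebra_simps)
  then have "\<lfloor>(real k)\<^sup>2 / 2\<rfloor> = int (2 * (j * (j + 1)))"
    by (intro floor_unique) linarith+
  moreover have "k div 2 = j" "k - k div 2 = j + 1" using k by auto
  ultimately show ?thesis by simp
qed

text \<open>The source of the gain \<epsilon>: one set reverses more pairs as a clique than on
  average as a quarter of a bipartite graph. For \<open>k = 2\<close> the two numbers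
  coincide.\<close>

lemma halves_less_choose_two:
  assumes "k \<ge> 3"
  shows "(k div 2) * (k - k div 2) < k choose 2"
proof (cases "even k")
  case True
  then obtain j where k: "k = 2 * j" by (rule evenE)
  then have "j \<ge> 2" using assms by simp
  then have "j * j < j * (2 * j - 1)" by simp
  then show ?thesis using k by (simp add: choose_two)
next
  case False
  then obtain j where k: "k = 2 * j + 1" by (rule oddE)
  then have "j \<ge> 1" using assms by simp
  then show ?thesis using k by (simp add: choose_two algebra_simps)
qed

text \<open>The order \<open>f\<close> saves sets on its backward cliques but may have too many
  backward pairs. Its cost plus that of the opposite order is below twice the bound, so one of the
  two orders suffices.\<close>

theorem tournament_flips_upper:
  assumes k: "k \<ge> 3"
  shows "\<exists>\<epsilon>>0. \<exists>n0. \<forall>(V :: 'a set) T. finite V \<longrightarrow> n0 \<le> card V \<longrightarrow> tournament_on V T \<longrightarrow>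
      (\<exists>f t. inj_on f V \<and> flips V k t (back_edges T f) \<and>
        real t \<le> (1 / (2 * real_of_int \<lfloor>(real k)\<^sup>2 / 2\<rfloor>) - \<epsilon>) * (real (card V))\<^sup>2)"
proof -
  define a where "a = k div 2"
  define b where "b = k - k div 2"
  define s where "s = real (a * b)"
  define q where "q = real (k choose 2)"
  have ab: "a \<ge> 1" "b \<ge> 1" "a + b \<le> k" using k by (auto simp: a_def b_def)
  have s: "s > 0" using ab by (simp add: s_def)
  have qs: "q > s" using halves_less_choose_two[OF k] by (simp only: q_def s_def a_def b_def of_nat_less_iff)
  have fl: "2 * real_of_int \<lfloor>(real k)\<^sup>2 / 2\<rfloor> = 4 * s"
    unfolding floor_half_square by (simp add: s_def a_def b_def)
  \<comment> \<open>At least \<open>n^2 / (4 * 2 ^ k * q)\<close> sets are packed, and a fraction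
    \<open>1 / k ^ k\<close> of them is backward under \<open>f\<close>.\<close>
  define c where "c = 1 / (4 * 2 ^ k * q * real (k ^ k))"
  have c: "c > 0" using qs s k by (simp add: c_def)
  \<comment> \<open>The saving \<open>(q / s - 1) * c\<close> is split into four: two parts pay for
    the error terms of the two orders, two remain as the gain of each order.\<close>
  define \<epsilon> where "\<epsilon> = (q / s - 1) * c / 4"
  have "q / s > 1" using qs s by simp
  then have \<epsilon>: "\<epsilon> > 0" using c by (simp add: \<epsilon>_def)
  obtain n1 where n1: "\<forall>(V :: 'a set) E. finite V \<longrightarrow> n1 \<le> card V \<longrightarrow> E \<subseteq> nsets V 2 \<longrightarrow>
    (\<exists>t. flips V k t E \<and> real t \<le> real (card E) / real (a * b) + \<epsilon> * (real (card V))\<^sup>2)"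
    using flips_asymptotic[OF \<epsilon> ab, where 'a = 'a] by blast
  have "\<exists>f t. inj_on f V \<and> flips V k t (back_edges T f) \<and>
        real t \<le> (1 / (2 * real_of_int \<lfloor>(real k)\<^sup>2 / 2\<rfloor>) - \<epsilon>) * (real (card V))\<^sup>2"
    if V: "finite V" "max n1 (2 * 2 ^ k) \<le> card V" and T: "tournament_on V T" for V :: "'a set" and T
  proof -
    define n where "n = real (card V)"
    have "2 * 2 ^ k \<le> card V" using V(2) by simp
    then have "real (2 * 2 ^ k) \<le> n" unfolding n_def of_nat_le_iff .
    then have n: "n \<ge> 2 * 2 ^ k" by simp
    obtain P where P: "finite P" "\<And>X. X \<in> P \<Longrightarrow> X \<subseteq> V \<and> transitive_set T k X"
      "\<And>X Y. X \<in> P \<Longrightarrow> Y \<in> P \<Longrightarrow> X \<noteq> Y \<Longrightarrow> nsets X 2 \<inter> nsets Y 2 = {}"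
      "n\<^sup>2 / (2 * 2 ^ k) - n / 2 \<le> q * real (card P)"
      using transitive_packing[OF T V(1), of k] k unfolding n_def q_def by auto
    have "1 \<le> k" using k by simp
    then obtain f :: "'a \<Rightarrow> int" and Q where Q: "inj_on f V" "Q \<subseteq> P" "card P \<le> card Q * k ^ k"
      "\<And>X. X \<in> Q \<Longrightarrow> nsets X 2 \<subseteq> back_edges T f"
      using separating_order[OF T V(1) _ P(1,2)] by metis
    have finQ: "finite Q" using P(1) Q(2) finite_subset by blast
    have cardQ: "c * n\<^sup>2 \<le> real (card Q)"
    proof -
      \<comment> \<open>For such \<open>n\<close> the linear term \<open>n / 2\<close> is at most
        half of the quadratic one.\<close>
      have "2 * 2 ^ k * n \<le> n * n" using n by (intro mult_right_mono) (auto simp: n_def)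
      then have "n\<^sup>2 / (4 * 2 ^ k) \<le> n\<^sup>2 / (2 * 2 ^ k) - n / 2"
        by (simp add: field_simps power2_eq_square)
      also have "\<dots> \<le> q * real (card P)" by (rule P(4))
      also have "\<dots> \<le> q * real (card Q * k ^ k)"
        using Q(3) qs s by (intro mult_left_mono) (auto simp del: of_nat_mult)
      finally have "n\<^sup>2 / (4 * 2 ^ k) \<le> real (card Q) * (q * real (k ^ k))" by (simp add: mult_ac)
      then show ?thesis
        using qs s k by (simp add: c_def field_simps)
    qed
    define K where "K = (\<Union>X\<in>Q. nsets X 2)"
    define E where "E = back_edges T f"
    define E' where "E' = back_edges T (\<lambda>v. - f v)"
    have sub: "E \<subseteq> nsets V 2" "E' \<subseteq> nsets V 2"
      unfolding E_def E'_def using back_edges_sub[OF T] by blast+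
    have finE: "finite E" using sub V(1) finite_imp_finite_nsets finite_subset by metis
    have KE: "K \<subseteq> E" using Q(4) by (auto simp: K_def E_def)
    have "card K = (\<Sum>X\<in>Q. card (nsets X 2))"
      unfolding K_def
    proof (rule card_UN_disjoint[OF finQ])
      show "\<forall>X\<in>Q. finite (nsets X 2)"
        using P(2) Q(2) by (auto simp: transitive_set_def intro!: finite_imp_finite_nsets)
      show "\<forall>X\<in>Q. \<forall>Y\<in>Q. X \<noteq> Y \<longrightarrow> nsets X 2 \<inter> nsets Y 2 = {}"
        using P(3) Q(2) by blast
    qed
    also have "\<dots> = (\<Sum>X\<in>Q. k choose 2)"
      using P(2) Q(2) by (intro sum.cong refl) (auto simp: transitive_set_def card_nsets)
    finally have "real (card K) = q * real (card Q)" by (simp add: q_def)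
    moreover have "card E = card K + card (E - K)"
      using KE finE by (metis card_Int_Diff inf.absorb2)
    ultimately have EK: "real (card E) = q * real (card Q) + real (card (E - K))" by simp
    have flK: "flips V k (card Q) K"
      unfolding K_def
    proof (rule flips_disjoint_cliques[OF V(1) finQ])
      show "X \<subseteq> V \<and> card X \<le> k" if "X \<in> Q" for X
      proof -
        have "X \<subseteq> V \<and> transitive_set T k X" using P(2) Q(2) that by blast
        then show ?thesis by (simp add: transitive_set_def)
      qed
      show "nsets X 2 \<inter> nsets Y 2 = {}" if "X \<in> Q" "Y \<in> Q" "X \<noteq> Y" for X Y
        using P(3) Q(2) that by blast
    qed
    obtain t1 where t1: "flips V k t1 (E - K)" "real t1 \<le> real (card (E - K)) / s + \<epsilon> * n\<^sup>2"
      using n1 V sub(1) unfolding s_def n_def by (metis Diff_subset max.boundedE order_trans)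
    obtain t2 where t2: "flips V k t2 E'" "real t2 \<le> real (card E') / s + \<epsilon> * n\<^sup>2"
      using n1 V sub(2) unfolding s_def n_def by (metis max.boundedE)
    have fl1: "flips V k (card Q + t1) E"
      using flips_union[OF V(1) flK t1(1)] KE by (simp add: Un_absorb1 Diff_partition)
    have N: "real (card E) + real (card E') \<le> n\<^sup>2 / 2"
    proof -
      have "real (card E) + real (card E') = real (card V choose 2)"
        using card_back_edges_reverse[OF T V(1) Q(1)] unfolding E_def E'_def
        by (metis of_nat_add)
      also have "\<dots> \<le> n\<^sup>2 / 2" by (simp add: real_choose_two n_def power2_eq_square algebra_simps)
      finally show ?thesis .
    qed
    define B where "B = (1 / (4 * s) - \<epsilon>) * n\<^sup>2"
    \<comment> \<open>Compared with reversing everything by bipartite graphs, each clique costs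
      \<open>1\<close> instead of \<open>q / s\<close>.\<close>
    have "real (card Q + t1) + real t2 \<le> real (card Q)
        + (real (card (E - K)) + real (card E')) / s + 2 * (\<epsilon> * n\<^sup>2)"
      using t1 t2 by (simp add: add_divide_distrib)
    also have "real (card (E - K)) + real (card E') \<le> n\<^sup>2 / 2 - q * real (card Q)"
      using EK N by linarith
    then have "(real (card (E - K)) + real (card E')) / s \<le> (n\<^sup>2 / 2 - q * real (card Q)) / s"
      using s by (intro divide_right_mono) auto
    finally have "real (card Q + t1) + real t2 \<le>
        n\<^sup>2 / (2 * s) - (q / s - 1) * real (card Q) + 2 * (\<epsilon> * n\<^sup>2)"
      by (simp add: diff_divide_distrib algebra_simps)
    also have "\<dots> \<le> n\<^sup>2 / (2 * s) - (q / s - 1) * (c * n\<^sup>2) + 2 * (\<epsilon> * n\<^sup>2)"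
      using cardQ \<open>q / s > 1\<close> by (simp add: mult_left_mono)
    also have "\<dots> = B + B" by (simp add: B_def \<epsilon>_def field_simps)
    finally have "real (card Q + t1) \<le> B \<or> real t2 \<le> B" by linarith
    then show ?thesis
    proof
      assume "real (card Q + t1) \<le> B"
      then show ?thesis using Q(1) fl1 unfolding E_def B_def n_def fl by blast
    next
      assume "real t2 \<le> B"
      moreover have "inj_on (\<lambda>v. - f v) V" using Q(1) by (auto simp: inj_on_def)
      ultimately show ?thesis using t2(1) unfolding E'_def B_def n_def fl by blast
    qed
  qed
  with \<epsilon> show ?thesis by blast
qed

section \<open>From reversed pairs to inversion numbers\<close>

lemma acyclic_if_increasing:
  fixes f :: "'a \<Rightarrow> int"
  assumes "\<And>u v. (u, v) \<in> r \<Longrightarrow> f u < f v"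
  shows "acyclic r"
proof -
  have "f u < f v" if "(u, v) \<in> r\<^sup>+" for u v
    using that by (induction rule: trancl_induct) (auto dest: assms)
  then show ?thesis unfolding acyclic_def by blast
qed

text \<open>After reversing exactly the backward pairs of \<open>T\<close>, every arc of
  \<open>D\<close> increases \<open>f\<close>; pairs that are not arcs of \<open>D\<close> do no
  harm.\<close>

lemma inv_num_le_flips:
  assumes D: "oriented_graph D" and T: "tournament_on (pverts D) T" "parcs D \<subseteq> T"
    and f: "inj_on f (pverts D)" and fl: "flips (pverts D) k t (back_edges T f)"
  shows "inv_num k D \<le> t"
proof -
  interpret oriented_graph D by fact
  obtain F where F: "F \<subseteq> Pow (pverts D)" "card F \<le> t" "\<forall>X\<in>F. card X \<le> k"
    "\<And>e. e \<in> nsets (pverts D) 2 \<Longrightarrow> odd (card {X \<in> F. e \<subseteq> X}) \<longleftrightarrow> e \<in> back_edges T f"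
    using fl unfolding flips_def by blast
  have finF: "finite F" using F(1) by (meson finite_Pow_iff finite_subset pair_finite_verts)
  have "f u < f v" if uv: "(u, v) \<in> parcs (invert_family F D)" for u v
  proof -
    have arc: "(u, v) \<in> T \<or> (v, u) \<in> T"
      using uv in_parcs_invert_family_iff[OF finF, of u v D] T(2) by (auto split: if_splits)
    then have V: "u \<in> pverts D" "v \<in> pverts D" "u \<noteq> v"
      using T(1) by (auto simp: tournament_on_def)
    then have ne: "f u \<noteq> f v" using f by (auto dest: inj_onD)
    have odd_iff: "odd (card {X \<in> F. u \<in> X \<and> v \<in> X}) \<longleftrightarrow> {u, v} \<in> back_edges T f"
      using F(4)[of "{u, v}"] V by simp
    show ?thesis
    proof (cases "{u, v} \<in> back_edges T f")
      case True
      then have "(v, u) \<in> T"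
        using uv in_parcs_invert_family_iff[OF finF, of u v D] odd_iff T(2) by (auto split: if_splits)
      then show ?thesis using back_edges_iff[OF T(1), of v u f] True by (simp add: insert_commute)
    next
      case False
      then have "(u, v) \<in> T"
        using uv in_parcs_invert_family_iff[OF finF, of u v D] odd_iff T(2) by (auto split: if_splits)
      then show ?thesis using back_edges_iff[OF T(1), of u v f] False ne by simp
    qed
  qed
  then have "acyclic (parcs (invert_family F D))" by (rule acyclic_if_increasing)
  then have "decycling k D F" using F(1,3) by (auto simp: decycling_def)
  then have "inv_num k D \<le> card F" unfolding inv_num_def by (intro Least_le) blast
  with F(2) show ?thesis by linarith
qed

lemma oriented_graph_extend:
  assumes "oriented_graph D"
  shows "\<exists>T. tournament_on (pverts D) T \<and> parcs D \<subseteq> T"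
proof -
  interpret oriented_graph D by fact
  obtain idx :: "'a \<Rightarrow> nat" where idx: "inj_on idx (pverts D)"
    using finite_imp_inj_to_nat_seg pair_finite_verts by metis
  define T where "T = parcs D \<union> {(u, v). u \<in> pverts D \<and> v \<in> pverts D \<and>
    (u, v) \<notin> parcs D \<and> (v, u) \<notin> parcs D \<and> idx u < idx v}"
  have "tournament_on (pverts D) T"
    unfolding tournament_on_def
  proof (intro conjI allI ballI impI)
    show "T \<subseteq> pverts D \<times> pverts D"
      by (auto simp: T_def dest: in_arcsD1 in_arcsD2)
    show "(v, u) \<notin> T" if "(u, v) \<in> T" for u v
      using that asym_arcs by (auto simp: T_def dest: asymD)
    show "(u, v) \<in> T \<or> (v, u) \<in> T" if "u \<in> pverts D" "v \<in> pverts D" "u \<noteq> v" for u v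
    proof -
      have "idx u \<noteq> idx v" using that idx by (auto dest: inj_onD)
      then show ?thesis using that(1,2) by (auto simp: T_def)
    qed
  qed
  then show ?thesis by (auto simp: T_def)
qed

lemma max_inv_num_attained:
  assumes "k \<ge> 2"
  obtains D :: "nat pair_pre_digraph"
  where "oriented_graph D" "card (pverts D) = n" "max_inv_num k n = inv_num k D"
  using Max_in[OF finite_inv_nums[OF assms] inv_nums_nonempty, of n]
  unfolding max_inv_num_def by blast

theorem max_inv_num_upper:
  assumes k: "k \<ge> 3"
  shows "\<exists>\<epsilon>>0. \<exists>n0. \<forall>n\<ge>n0.
      real (max_inv_num k n) \<le> (1 / (2 * real_of_int \<lfloor>(real k)\<^sup>2 / 2\<rfloor>) - \<epsilon>) * (real n)\<^sup>2"
proof -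
  obtain \<epsilon> :: real and n0 where \<epsilon>: "\<epsilon> > 0" and up:
    "\<forall>(V :: nat set) T. finite V \<longrightarrow> n0 \<le> card V \<longrightarrow> tournament_on V T \<longrightarrow>
      (\<exists>f t. inj_on f V \<and> flips V k t (back_edges T f) \<and>
        real t \<le> (1 / (2 * real_of_int \<lfloor>(real k)\<^sup>2 / 2\<rfloor>) - \<epsilon>) * (real (card V))\<^sup>2)"
    using tournament_flips_upper[OF k, where 'a = nat] by blast
  have "real (max_inv_num k n) \<le> (1 / (2 * real_of_int \<lfloor>(real k)\<^sup>2 / 2\<rfloor>) - \<epsilon>) * (real n)\<^sup>2"
    if n: "n0 \<le> n" for n
  proof -
    have "k \<ge> 2" using k by simp
    then obtain D :: "nat pair_pre_digraph" where D: "oriented_graph D" "card (pverts D) = n"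
      "max_inv_num k n = inv_num k D"
      by (rule max_inv_num_attained)
    interpret oriented_graph D by (rule D(1))
    obtain T where T: "tournament_on (pverts D) T" "parcs D \<subseteq> T"
      using oriented_graph_extend[OF D(1)] by blast
    obtain f t where "inj_on f (pverts D)" "flips (pverts D) k t (back_edges T f)"
      "real t \<le> (1 / (2 * real_of_int \<lfloor>(real k)\<^sup>2 / 2\<rfloor>) - \<epsilon>) * (real n)\<^sup>2"
      using up[rule_format, OF pair_finite_verts _ T(1)] n D(2) by auto
    moreover from this have "inv_num k D \<le> t" using inv_num_le_flips[OF D(1) T] by blast
    ultimately show ?thesis unfolding D(3) by (meson of_nat_le_iff order_trans)
  qed
  with \<epsilon> show ?thesis by blast
qed

subsection \<open>Blow-ups of tournaments\<close>

lemma acyclic_pullback: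
  assumes "acyclic s" "\<And>x y. (x, y) \<in> r \<Longrightarrow> (\<phi> x, \<phi> y) \<in> s"
  shows "acyclic r"
proof -
  have "(\<phi> x, \<phi> y) \<in> s\<^sup>+" if "(x, y) \<in> r\<^sup>+" for x y
    using that by (induction rule: trancl_induct) (auto intro: assms(2) trancl_into_trancl)
  then show ?thesis using assms(1) unfolding acyclic_def by blast
qed

text \<open>On \<open>C\<close> the relation \<open>B\<close> is a linear order, so
  out-neighbourhoods shrink strictly along arcs and the out-degree within \<open>C\<close> is the
  required rank. The map \<pi> will be the projection of a blow-up onto its parts.\<close>

lemma transitive_set_if_complete_acyclic:
  assumes "finite C" "acyclic B" "\<And>u v. u \<in> C \<Longrightarrow> v \<in> C \<Longrightarrow> u \<noteq> v \<Longrightarrow> (u, v) \<in> B \<or> (v, u) \<in> B"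
    and "inj_on \<pi> C" "\<And>u v. u \<in> C \<Longrightarrow> v \<in> C \<Longrightarrow> (\<pi> u, \<pi> v) \<in> R \<Longrightarrow> (u, v) \<in> B"
  shows "transitive_set R (card C) (\<pi> ` C)"
proof -
  define h where "h u = card {x \<in> C. (u, x) \<in> B}" for u
  have acy: "(u, u) \<notin> B\<^sup>+" for u using assms(2) by (auto simp: acyclic_def)
  have h_less: "h v < h u" if uv: "u \<in> C" "v \<in> C" "(u, v) \<in> B" for u v
  proof -
    have "(u, x) \<in> B" if x: "x \<in> C" "(v, x) \<in> B" for x
    proof (rule ccontr)
      assume "(u, x) \<notin> B"
      then have "x = u \<or> (x, u) \<in> B" using assms(3) x(1) uv(1) by blast
      moreover have "(u, x) \<in> B\<^sup>+" using uv(3) x(2) by auto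
      ultimately have "(u, u) \<in> B\<^sup>+" by (auto intro: trancl_into_trancl)
      then show False using acy by blast
    qed
    moreover have "(v, v) \<notin> B" using acy by blast
    ultimately have "{x \<in> C. (v, x) \<in> B} \<subset> {x \<in> C. (u, x) \<in> B}" using uv by blast
    then show ?thesis unfolding h_def using assms(1) by (intro psubset_card_mono) auto
  qed
  have h_bound: "h u < card C" if "u \<in> C" for u
  proof -
    have "(u, u) \<notin> B" using acy by blast
    then have "{x \<in> C. (u, x) \<in> B} \<subset> C" using that by blast
    then show ?thesis unfolding h_def using assms(1) by (intro psubset_card_mono) auto
  qed
  define g where "g = h \<circ> inv_into C \<pi>"
  have g: "g (\<pi> u) = h u" if "u \<in> C" for u
    using that assms(4) by (simp add: g_def)
  have "g ` \<pi> ` C \<subseteq> {..<card C}" using g h_bound by auto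
  moreover have "\<forall>x\<in>\<pi> ` C. \<forall>y\<in>\<pi> ` C. (x, y) \<in> R \<longrightarrow> g y < g x"
    using g h_less assms(5) by auto
  ultimately show ?thesis
    unfolding transitive_set_def using assms(1,4) by (auto simp: card_image intro!: exI[of _ g])
qed

locale blowup =
  fixes R :: "(nat \<times> nat) set" and r q n :: nat and f :: real and w :: nat
  assumes R: "tournament_on {..<r} R"
    and r: "r \<ge> 2" and q: "q \<ge> 1" and n: "r * q \<le> n" and w: "w \<ge> 1"
    and fas: "\<And>B. B \<subseteq> R \<Longrightarrow> acyclic (R - B) \<Longrightarrow> f \<le> real (card B)"
    and no_transitive: "\<And>X. X \<subseteq> {..<r} \<Longrightarrow> \<not> transitive_set R (Suc w) X"
begin

text \<open>
  The blow-up of \<open>R\<close> has \<open>r\<close> independent parts of size \<open>q\<close>, the residue classes modulo \<open>r\<close>; the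
  vertices from \<open>r * q\<close> on are isolated.
\<close>

definition D :: "nat pair_pre_digraph" where
  "D = \<lparr>pverts = {..<n}, parcs = {(u, v). u < r * q \<and> v < r * q \<and> (u mod r, v mod r) \<in> R}\<rparr>"

lemma R_irrefl: "(i, i) \<notin> R" and R_asym: "(i, j) \<in> R \<Longrightarrow> (j, i) \<notin> R"
  using R by (auto simp: tournament_on_def)

lemma R_less: "(i, j) \<in> R \<Longrightarrow> i < r \<and> j < r"
  using R by (auto simp: tournament_on_def)

lemma finite_parcs_D: "finite (parcs D)"
proof -
  have "parcs D \<subseteq> {..<n} \<times> {..<n}" using n by (auto simp: D_def)
  then show ?thesis by (rule finite_subset) simp
qed

lemma oriented_D: "oriented_graph D"
  using n R_irrefl R_asym finite_parcs_D by unfold_locales (auto simp: D_def asym_on_def)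

text \<open>
  Average over all transversals \<open>c\<close>, where \<open>c i\<close> selects the vertex \<open>c i * r + i\<close> of part \<open>i\<close>: each
  spans a copy of \<open>R\<close>, and each arc lies in \<open>q ^ (r - 2)\<close> of them.
\<close>

lemma feedback_blowup:
  assumes BD: "B \<subseteq> parcs D" and acy: "acyclic (parcs D - B)"
  shows "f * (real q)\<^sup>2 \<le> real (card B)"
proof -
  define C where "C = {..<r} \<rightarrow>\<^sub>E {..<q}"
  define agree where "agree c p \<longleftrightarrow> c (fst p mod r) = fst p div r \<and> c (snd p mod r) = snd p div r"
    for c :: "nat \<Rightarrow> nat" and p
  have finB: "finite B" using BD finite_parcs_D finite_subset by blast
  have finC: "finite C" unfolding C_def by (intro finite_PiE) auto
  have cardC: "card C = q ^ r" by (simp add: C_def card_PiE)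
  \<comment> \<open>Pulled back along \<phi>, the arcs of \<open>B\<close> inside the copy selected
    by \<open>c\<close> form a feedback arc set of \<open>R\<close>.\<close>
  have many: "f \<le> real (card {p \<in> B. agree c p})" if c: "c \<in> C" for c
  proof -
    define \<phi> where "\<phi> i = c i * r + i" for i
    define Bc where "Bc = {(i, j) \<in> R. (\<phi> i, \<phi> j) \<in> B}"
    have \<phi>: "\<phi> i < r * q" "\<phi> i mod r = i" "\<phi> i div r = c i" if "i < r" for i
    proof -
      have "c i < q" using c that by (auto simp: C_def)
      then have "Suc (c i) * r \<le> q * r" by (intro mult_le_mono1) simp
      then show "\<phi> i < r * q" using that by (simp add: \<phi>_def mult.commute)
      show "\<phi> i mod r = i" "\<phi> i div r = c i" using that by (simp_all add: \<phi>_def)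
    qed
    have "acyclic (R - Bc)"
    proof (rule acyclic_pullback[OF acy, where \<phi> = \<phi>])
      fix i j assume ij: "(i, j) \<in> R - Bc"
      then have "i < r" "j < r" using R_less by auto
      with ij \<phi> show "(\<phi> i, \<phi> j) \<in> parcs D - B" by (auto simp: D_def Bc_def)
    qed
    then have "f \<le> real (card Bc)" by (intro fas) (auto simp: Bc_def)
    also have "card Bc \<le> card {p \<in> B. agree c p}"
    proof (rule card_inj_on_le)
      show "inj_on (map_prod \<phi> \<phi>) Bc"
      proof (rule inj_onI)
        fix p p' assume "p \<in> Bc" "p' \<in> Bc" "map_prod \<phi> \<phi> p = map_prod \<phi> \<phi> p'"
        then show "p = p'" using \<phi>(2) R_less
          by (auto simp: Bc_def) (metis)+
      qed
      show "map_prod \<phi> \<phi> ` Bc \<subseteq> {p \<in> B. agree c p}"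
        using \<phi> R_less by (auto simp: Bc_def agree_def)
    qed (use finB in auto)
    finally show ?thesis by simp
  qed
  \<comment> \<open>No arc of \<open>D\<close> stays inside a part, so the ends of \<open>p\<close>
    fix \<open>c\<close> at two distinct places.\<close>
  have few: "card {c \<in> C. agree c p} * q\<^sup>2 = q ^ r" if p: "p \<in> B" for p
  proof -
    obtain u v where uv: "p = (u, v)" by (cases p)
    then have *: "u < r * q" "v < r * q" "(u mod r, v mod r) \<in> R" using p BD by (auto simp: D_def)
    have ne: "u mod r \<noteq> v mod r" using *(3) R_irrefl by metis
    have lt: "u mod r < r" "v mod r < r" using r by simp_all
    have lq: "u div r < q" "v div r < q"
      using * by (auto simp: less_mult_imp_div_less mult.commute)
    have "{c \<in> C. agree c p} = (\<Pi>\<^sub>E i\<in>{..<r}. if i = u mod r then {u div r}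
        else if i = v mod r then {v div r} else {..<q})" (is "_ = ?P")
    proof (intro equalityI subsetI)
      fix c assume "c \<in> ?P"
      then have c: "c i \<in> (if i = u mod r then {u div r}
          else if i = v mod r then {v div r} else {..<q})" if "i < r" for i
        using that by (auto simp: PiE_iff)
      have "c i < q" if "i < r" for i
        using c[OF that] lq by (auto split: if_splits)
      moreover have "agree c p"
        using c[OF lt(1)] c[OF lt(2)] ne by (simp add: agree_def uv)
      ultimately show "c \<in> {c \<in> C. agree c p}"
        using \<open>c \<in> ?P\<close> by (auto simp: C_def PiE_iff)
    qed (auto simp: C_def agree_def uv PiE_iff)
    then have "card {c \<in> C. agree c p} = (\<Prod>i<r. if i = u mod r \<or> i = v mod r then 1 else q)"
      unfolding \<open>{c \<in> C. agree c p} = ?P\<close> card_PiE[OF finite_lessThan]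
      by (intro prod.cong refl) simp
    also have "\<dots> = (\<Prod>i\<in>{..<r} - {u mod r, v mod r}. q)"
      by (intro prod.mono_neutral_cong_right) auto
    also have "\<dots> = q ^ (r - 2)" using ne lt by (simp add: card_Diff_subset numeral_2_eq_2)
    finally have "card {c \<in> C. agree c p} = q ^ (r - 2)" .
    moreover have "q ^ (r - 2) * q\<^sup>2 = q ^ r" using r by (metis le_add_diff_inverse2 power_add)
    ultimately show ?thesis by simp
  qed
  have "f * real (q ^ r) = (\<Sum>c\<in>C. f)" by (simp add: cardC)
  also have "\<dots> \<le> (\<Sum>c\<in>C. real (card {p \<in> B. agree c p}))" by (intro sum_mono many)
  also have "\<dots> = real (\<Sum>p\<in>B. card {c \<in> C. agree c p})"
    using sum_multicount_gen[OF finC finB, of agree "\<lambda>p. card {c \<in> C. agree c p}"] by (simp flip: of_nat_sum)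
  finally have "f * real (q ^ r) * real (q\<^sup>2) \<le> real (\<Sum>p\<in>B. card {c \<in> C. agree c p}) * real (q\<^sup>2)"
    by (intro mult_right_mono) auto
  also have "\<dots> = real (\<Sum>p\<in>B. card {c \<in> C. agree c p} * q\<^sup>2)"
    by (simp add: sum_distrib_right)
  also have "(\<Sum>p\<in>B. card {c \<in> C. agree c p} * q\<^sup>2) = card B * q ^ r"
    by (simp add: few)
  finally have "(f * (real q)\<^sup>2) * real q ^ r \<le> real (card B) * real q ^ r"
    by (simp add: mult_ac)
  then show ?thesis using q by simp
qed

text \<open>Acyclic arcs within \<open>X\<close> form a simple graph, which gives the first bound. A
  clique on \<open>w + 1\<close> vertices in it has at most one vertex per part and projects to a
  transitive set of \<open>R\<close>; excluding it gives the second bound by Turan.\<close>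

lemma card_acyclic_within:
  assumes BD: "B \<subseteq> parcs D" and acy: "acyclic B" and X: "finite X" "card X \<le> k"
  shows "real (card (B \<inter> X \<times> X)) \<le> real (k choose 2)"
    and "real (card (B \<inter> X \<times> X)) \<le> (1 - 1 / real w) * (real k)\<^sup>2 / 2"
proof -
  define E where "E = (\<lambda>(u, v). {u, v}) ` (B \<inter> X \<times> X)"
  have BR: "(u mod r, v mod r) \<in> R" if "(u, v) \<in> B" for u v
    using that BD by (auto simp: D_def)
  have asy: "(u, v) \<in> B \<Longrightarrow> (v, u) \<notin> B" and irr: "(u, u) \<notin> B" for u v
    using BR R_irrefl R_asym by blast+
  have "inj_on (\<lambda>(u, v). {u, v}) (B \<inter> X \<times> X)"
    using asy by (auto simp: inj_on_def doubleton_eq_iff)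
  then have cE: "card (B \<inter> X \<times> X) = card E" by (simp add: E_def card_image)
  have sub: "E \<subseteq> nsets X 2" using irr by (auto simp: E_def)
  have "card E \<le> card (nsets X 2)" using sub X(1) by (intro card_mono finite_imp_finite_nsets)
  also have "\<dots> \<le> k choose 2" using X(2) by (simp add: card_nsets binomial_right_mono)
  finally show "real (card (B \<inter> X \<times> X)) \<le> real (k choose 2)" unfolding cE by simp
  have "real (card E) \<le> (1 - 1 / real w) * (real (card X))\<^sup>2 / 2"
  proof (rule turan_bound[OF w X(1) sub])
    fix C assume C: "C \<subseteq> X" "card C = Suc w"
    show "\<not> nsets C 2 \<subseteq> E"
    proof
      assume CE: "nsets C 2 \<subseteq> E"
      have compl: "(u, v) \<in> B \<or> (v, u) \<in> B" if "u \<in> C" "v \<in> C" "u \<noteq> v" for u v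
      proof -
        have "{u, v} \<in> E" using CE that by auto
        then show ?thesis by (auto simp: E_def doubleton_eq_iff)
      qed
      have "inj_on (\<lambda>u. u mod r) C"
        using compl BR R_irrefl by (intro inj_onI) metis
      moreover have "(u, v) \<in> B" if "u \<in> C" "v \<in> C" "(u mod r, v mod r) \<in> R" for u v
        using compl[OF that(1,2)] that(3) BR R_irrefl R_asym by metis
      moreover have "finite C" using C(1) X(1) finite_subset by blast
      ultimately have "transitive_set R (card C) ((\<lambda>u. u mod r) ` C)"
        using compl by (intro transitive_set_if_complete_acyclic[OF _ acy])
      moreover have "(\<lambda>u. u mod r) ` C \<subseteq> {..<r}" using r by auto
      ultimately show False using no_transitive C(2) by simp
    qed
  qed
  also have "\<dots> \<le> (1 - 1 / real w) * (real k)\<^sup>2 / 2"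
    using X(2) w by (intro divide_right_mono mult_left_mono power_mono) auto
  finally show "real (card (B \<inter> X \<times> X)) \<le> (1 - 1 / real w) * (real k)\<^sup>2 / 2" unfolding cE .
qed

text \<open>Let \<open>B\<close> be the arcs reversed by an optimal family. The kept arcs
  \<open>parcs D - B\<close> and the converse of \<open>B\<close> both lie in the resulting acyclic
  digraph. Hence \<open>B\<close> is a feedback arc set, so it is large, and it is acyclic, so each
  set contains few of its arcs; every arc of \<open>B\<close> lies in some set.\<close>

theorem max_inv_num_lower:
  assumes k: "k \<ge> 2"
  shows "f * (real q)\<^sup>2 \<le> real (max_inv_num k n) * real (k choose 2)"
    and "f * (real q)\<^sup>2 \<le> real (max_inv_num k n) * ((1 - 1 / real w) * (real k)\<^sup>2 / 2)"
proof -
  have "inv_num k D \<in> {inv_num k D | D :: nat pair_pre_digraph. oriented_graph D \<and> card (pverts D) = n}"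
    using oriented_D by (auto simp: D_def)
  then have le: "inv_num k D \<le> max_inv_num k n"
    unfolding max_inv_num_def by (intro Max_ge finite_inv_nums[OF k])
  have "\<exists>t F. decycling k D F \<and> card F = t"
    using decycling_exists[OF oriented_D k] by blast
  then have "\<exists>F. decycling k D F \<and> card F = inv_num k D"
    unfolding inv_num_def by (rule LeastI_ex)
  then obtain F where F: "decycling k D F" "card F = inv_num k D" by blast
  have FV: "X \<subseteq> {..<n}" "card X \<le> k" if "X \<in> F" for X
    using F(1) that by (auto simp: decycling_def D_def)
  then have finX: "finite X" if "X \<in> F" for X using that finite_subset by blast
  have finF: "finite F" using FV(1) by (intro finite_subset[of F "Pow {..<n}"]) auto
  have acy: "acyclic (parcs (invert_family F D))" using F(1) by (simp add: decycling_def)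
  define B where "B = {(u, v) \<in> parcs D. odd (card {X \<in> F. u \<in> X \<and> v \<in> X})}"
  have BD: "B \<subseteq> parcs D" by (auto simp: B_def)
  have "acyclic (parcs D - B)"
    using acy by (rule acyclic_subset) (auto simp: B_def in_parcs_invert_family_iff[OF finF])
  then have lower: "f * (real q)\<^sup>2 \<le> real (card B)" by (rule feedback_blowup[OF BD])
  have "B\<inverse> \<subseteq> parcs (invert_family F D)"
    by (auto simp: B_def in_parcs_invert_family_iff[OF finF] conj_commute)
  then have acyB: "acyclic B" using acy acyclic_subset acyclic_converse by blast
  have "B \<subseteq> (\<Union>X\<in>F. B \<inter> X \<times> X)"
  proof
    fix p assume p: "p \<in> B"
    then obtain u v where uv: "p = (u, v)" "odd (card {X \<in> F. u \<in> X \<and> v \<in> X})"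
      by (auto simp: B_def)
    then have "{X \<in> F. u \<in> X \<and> v \<in> X} \<noteq> {}" by (metis card.empty even_zero)
    with p uv(1) show "p \<in> (\<Union>X\<in>F. B \<inter> X \<times> X)" by blast
  qed
  then have "card B \<le> card (\<Union>X\<in>F. B \<inter> X \<times> X)"
    using finF finX by (intro card_mono) auto
  also have "\<dots> \<le> (\<Sum>X\<in>F. card (B \<inter> X \<times> X))" by (rule card_UN_le[OF finF])
  finally have "real (card B) \<le> (\<Sum>X\<in>F. real (card (B \<inter> X \<times> X)))"
    by (metis of_nat_le_iff of_nat_sum)
  then have up: "f * (real q)\<^sup>2 \<le> real (max_inv_num k n) * b"
    if b: "\<And>X. X \<in> F \<Longrightarrow> real (card (B \<inter> X \<times> X)) \<le> b" "0 \<le> b" for b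
  proof -
    have "(\<Sum>X\<in>F. real (card (B \<inter> X \<times> X))) \<le> (\<Sum>X\<in>F. b)" by (intro sum_mono b)
    also have "\<dots> = real (inv_num k D) * b" by (simp add: F(2))
    also have "\<dots> \<le> real (max_inv_num k n) * b" using le b(2) by (intro mult_right_mono) auto
    finally show ?thesis using lower \<open>real (card B) \<le> _\<close> by linarith
  qed
  show "f * (real q)\<^sup>2 \<le> real (max_inv_num k n) * real (k choose 2)"
    by (rule up) (use card_acyclic_within(1)[OF BD acyB] finX FV in auto)
  show "f * (real q)\<^sup>2 \<le> real (max_inv_num k n) * ((1 - 1 / real w) * (real k)\<^sup>2 / 2)"
    by (rule up) (use card_acyclic_within(2)[OF BD acyB] finX FV w in auto)
qed

end

subsection \<open>Random tournaments\<close>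

text \<open>\<open>S\<close> collects the pairs directed upwards. Subsets of
  \<open>nsets {..<r} 2\<close> thus encode the tournaments on \<open>{..<r}\<close> bijectively,
  and probabilities for a uniformly random tournament become cardinalities.\<close>

definition orient :: "nat \<Rightarrow> nat set set \<Rightarrow> (nat \<times> nat) set" where
  "orient r S = {(i, j). i < r \<and> j < r \<and> i \<noteq> j \<and> (i < j \<longleftrightarrow> {i, j} \<in> S)}"

lemma tournament_orient: "tournament_on {..<r} (orient r S)"
proof -
  have *: "{j, i} = {i, j}" for i j :: nat by blast
  show ?thesis
    unfolding tournament_on_def orient_def by (auto simp: *)
qed

text \<open>Union bound over the at most \<open>r ^ k * k ^ k\<close> choices of a
  \<open>k\<close>-set with a rank function; each choice determines the direction of all
  \<open>k choose 2\<close> pairs inside the set.\<close>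

lemma card_few_transitive:
  "card {S \<in> Pow (nsets {..<r} 2). \<exists>X\<subseteq>{..<r}. transitive_set (orient r S) k X} * 2 ^ (k choose 2)
    \<le> r ^ k * k ^ k * 2 ^ (r choose 2)"
proof -
  define N where "N = nsets {..<r} 2"
  have finN: "finite N" by (simp add: N_def finite_imp_finite_nsets)
  have cN: "card N = r choose 2" by (simp add: N_def card_nsets)
  define Z where "Z X g = {S \<in> Pow N. \<forall>u\<in>X. \<forall>v\<in>X. (u, v) \<in> orient r S \<longrightarrow> g v < g u}"
    for X and g :: "nat \<Rightarrow> nat"
  define I where "I = (SIGMA X:nsets {..<r} k. X \<rightarrow>\<^sub>E {..<k})"
  have Z: "card (Z X g) * 2 ^ (k choose 2) \<le> 2 ^ (r choose 2)" if X: "X \<in> nsets {..<r} k" for X g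
  proof -
    have Xr: "X \<subseteq> {..<r}" and Xk: "card X = k" and finX: "finite X" using X by (auto simp: nsets_def)
    have subN: "nsets X 2 \<subseteq> N" unfolding N_def by (rule nsets_mono[OF Xr])
    have "card (Z X g) \<le> card (Pow (N - nsets X 2))"
    proof (rule card_inj_on_le)
      \<comment> \<open>Inside \<open>X\<close> the ranks \<open>g\<close> dictate which pairs
        belong to \<open>S\<close>, so the pairs not inside \<open>X\<close> determine
        \<open>S\<close>.\<close>
      show "inj_on (\<lambda>S. S - nsets X 2) (Z X g)"
      proof (rule inj_onI)
        fix S S' assume S: "S \<in> Z X g" "S' \<in> Z X g" and eq: "S - nsets X 2 = S' - nsets X 2"
        have "e \<in> S \<longleftrightarrow> e \<in> S'" if e: "e \<in> nsets X 2" for e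
        proof -
          obtain x y where xy: "e = {x, y}" "x \<in> X" "y \<in> X" "x < y"
            using e by (auto simp: ordered_nsets_2_eq)
          have "(x, y) \<in> orient r A \<longleftrightarrow> e \<in> A" "(y, x) \<in> orient r A \<longleftrightarrow> e \<notin> A" for A
            using xy Xr by (auto simp: orient_def insert_commute)
          moreover have "(x, y) \<in> orient r A \<Longrightarrow> g y < g x" "(y, x) \<in> orient r A \<Longrightarrow> g x < g y"
            if "A \<in> {S, S'}" for A
            using that S xy(2,3) by (auto simp: Z_def)
          ultimately show ?thesis by (metis insertI1 insertI2 less_asym)
        qed
        then show "S = S'" using eq by blast
      qed
      show "(\<lambda>S. S - nsets X 2) ` Z X g \<subseteq> Pow (N - nsets X 2)" by (auto simp: Z_def)
    qed (use finN in auto)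
    also have "\<dots> = 2 ^ (card N - card (nsets X 2))"
      using finN subN by (simp add: card_Pow card_Diff_subset finite_subset)
    also have "\<dots> * 2 ^ (k choose 2) = 2 ^ (r choose 2)"
      using card_mono[OF finN subN] Xk cN by (simp add: card_nsets flip: power_add)
    finally show ?thesis by simp
  qed
  have "{S \<in> Pow N. \<exists>X\<subseteq>{..<r}. transitive_set (orient r S) k X} \<subseteq> (\<Union>(X, g)\<in>I. Z X g)"
  proof
    fix S assume "S \<in> {S \<in> Pow N. \<exists>X\<subseteq>{..<r}. transitive_set (orient r S) k X}"
    then obtain X g where *: "S \<subseteq> N" "X \<subseteq> {..<r}" "finite X" "card X = k" "g ` X \<subseteq> {..<k}"
      "\<forall>u\<in>X. \<forall>v\<in>X. (u, v) \<in> orient r S \<longrightarrow> g v < g u"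
      by (auto simp: transitive_set_def)
    then have "(X, restrict g X) \<in> I" by (auto simp: I_def nsets_def)
    moreover have "S \<in> Z X (restrict g X)" using * by (auto simp: Z_def)
    ultimately show "S \<in> (\<Union>(X, g)\<in>I. Z X g)" by auto
  qed
  moreover have finI: "finite I"
    unfolding I_def by (intro finite_SigmaI finite_PiE finite_imp_finite_nsets) (auto simp: nsets_def)
  ultimately have "card {S \<in> Pow N. \<exists>X\<subseteq>{..<r}. transitive_set (orient r S) k X}
      \<le> card (\<Union>(X, g)\<in>I. Z X g)"
    using finN by (intro card_mono) (auto simp: Z_def)
  also have "\<dots> \<le> (\<Sum>p\<in>I. card (case p of (X, g) \<Rightarrow> Z X g))" by (rule card_UN_le[OF finI])
  finally have "card {S \<in> Pow N. \<exists>X\<subseteq>{..<r}. transitive_set (orient r S) k X} * 2 ^ (k choose 2)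
      \<le> (\<Sum>p\<in>I. card (case p of (X, g) \<Rightarrow> Z X g) * 2 ^ (k choose 2))"
    by (simp add: flip: sum_distrib_right)
  also have "\<dots> \<le> (\<Sum>p\<in>I. 2 ^ (r choose 2))"
    by (intro sum_mono) (use Z in \<open>auto simp: I_def\<close>)
  also have "\<dots> = card I * 2 ^ (r choose 2)" by simp
  also have "card I = (\<Sum>X\<in>nsets {..<r} k. card (X \<rightarrow>\<^sub>E {..<k}))"
    unfolding I_def by (intro card_SigmaI ballI finite_PiE finite_imp_finite_nsets) (auto simp: nsets_def)
  also have "\<dots> = (\<Sum>X\<in>nsets {..<r} k. k ^ k)"
    by (intro sum.cong refl) (auto simp: nsets_def card_PiE)
  also have "\<dots> = (r choose k) * k ^ k" by (simp add: card_nsets)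
  also have "\<dots> \<le> r ^ k * k ^ k"
    by (cases "k \<le> r") (auto simp: binomial_le_pow binomial_eq_0)
  finally show ?thesis by (simp add: N_def)
qed

section \<open>Feedback arc sets of random tournaments\<close>

lemma sum_power_card:
  fixes x :: real
  assumes "finite N"
  shows "(\<Sum>S\<in>Pow N. x ^ card S) = (1 + x) ^ card N"
  using prod_add[OF assms, of "\<lambda>_. x" "\<lambda>_. 1"] by (simp add: add.commute)

text \<open>Exponential moment method: since \<open>x \<le> 1\<close>, each counted \<open>S\<close>
  contributes at least \<open>x powr M\<close> to the generating function of all subsets by
  size.\<close>

lemma card_few_small:
  fixes x M :: real
  assumes "finite N" "0 < x" "x \<le> 1"
  shows "real (card {S \<in> Pow N. real (card S) < M}) * x powr M \<le> (1 + x) ^ card N"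
proof -
  have "real (card {S \<in> Pow N. real (card S) < M}) * x powr M
      = (\<Sum>S\<in>{S \<in> Pow N. real (card S) < M}. x powr M)" by simp
  also have "\<dots> \<le> (\<Sum>S\<in>{S \<in> Pow N. real (card S) < M}. x ^ card S)"
  proof (rule sum_mono)
    fix S assume "S \<in> {S \<in> Pow N. real (card S) < M}"
    then have "x powr M \<le> x powr real (card S)" using assms by (intro powr_mono') auto
    then show "x powr M \<le> x ^ card S" using assms(2) by (simp add: powr_realpow)
  qed
  also have "\<dots> \<le> (\<Sum>S\<in>Pow N. x ^ card S)"
    using assms by (intro sum_mono2) auto
  finally show ?thesis by (simp add: sum_power_card[OF assms(1)])
qed

text \<open>Union bound over \<open>r ^ r\<close> rank functions: deleting a small feedback arc set
  leaves an acyclic digraph that follows some \<open>f\<close>, so \<open>S\<close> differs from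
  \<open>U f\<close> in fewer than \<open>M\<close> pairs.\<close>

lemma card_few_feedback:
  fixes x M :: real
  assumes x: "0 < x" "x \<le> 1"
  shows "real (card {S \<in> Pow (nsets {..<r} 2). \<exists>B\<subseteq>orient r S. acyclic (orient r S - B) \<and> real (card B) < M})
    * x powr M \<le> real (r ^ r) * (1 + x) ^ (r choose 2)"
proof -
  define N where "N = nsets {..<r} 2"
  have finN: "finite N" by (simp add: N_def finite_imp_finite_nsets)
  have cN: "card N = r choose 2" by (simp add: N_def card_nsets)
  define U where "U f = {{i, j} | i j. i < j \<and> j < r \<and> f i \<le> f j}" for f :: "nat \<Rightarrow> nat"
  \<comment> \<open>\<open>sd S f\<close> consists of the pairs that \<open>orient r S\<close> directs against the order by \<open>f\<close>, where ties
    are broken by the numbering of the vertices so that \<open>S \<mapsto> sd S f\<close> is injective.\<close>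
  define sd where "sd S f = S - U f \<union> (U f - S)" for S f
  define Z where "Z f = {S \<in> Pow N. real (card (sd S f)) < M}" for f
  define I where "I = {..<r} \<rightarrow>\<^sub>E {..<r}"
  have finI: "finite I" unfolding I_def by (intro finite_PiE) auto
  have UN: "U f \<subseteq> N" for f by (auto simp: U_def N_def)
  have Z: "real (card (Z f)) * x powr M \<le> (1 + x) ^ (r choose 2)" for f
  proof -
    have "card (Z f) \<le> card {S \<in> Pow N. real (card S) < M}"
    proof (rule card_inj_on_le)
      show "inj_on (\<lambda>S. sd S f) (Z f)" by (auto simp: inj_on_def sd_def)
      show "(\<lambda>S. sd S f) ` Z f \<subseteq> {S \<in> Pow N. real (card S) < M}"
        using UN by (auto simp: Z_def sd_def)
    qed (use finN in auto)
    then have "real (card (Z f)) * x powr M \<le> real (card {S \<in> Pow N. real (card S) < M}) * x powr M"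
      by (intro mult_right_mono) auto
    also have "\<dots> \<le> (1 + x) ^ (r choose 2)" using card_few_small[OF finN x, of M] cN by simp
    finally show ?thesis .
  qed
  have "{S \<in> Pow N. \<exists>B\<subseteq>orient r S. acyclic (orient r S - B) \<and> real (card B) < M} \<subseteq> (\<Union>f\<in>I. Z f)"
  proof
    fix S assume "S \<in> {S \<in> Pow N. \<exists>B\<subseteq>orient r S. acyclic (orient r S - B) \<and> real (card B) < M}"
    then obtain B where B: "S \<subseteq> N" "B \<subseteq> orient r S" "acyclic (orient r S - B)" "real (card B) < M"
      by blast
    define A where "A = orient r S - B"
    have acy: "(v, v) \<notin> A\<^sup>+" for v using B(3) by (auto simp: acyclic_def A_def)
    \<comment> \<open>\<open>f\<close> counts the ancestors of a vertex in the acyclic remainder, so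
      it grows strictly along arcs of \<open>A\<close>; no vertex is its own ancestor, hence the
      values stay below \<open>r\<close>.\<close>
    define f where "f = (\<lambda>v\<in>{..<r}. card {u \<in> {..<r}. (u, v) \<in> A\<^sup>+})"
    have fr: "f v < r" if "v < r" for v
    proof -
      have "{u \<in> {..<r}. (u, v) \<in> A\<^sup>+} \<subset> {..<r}" using acy that by blast
      then have "card {u \<in> {..<r}. (u, v) \<in> A\<^sup>+} < card {..<r}" by (intro psubset_card_mono) auto
      then show ?thesis using that by (simp add: f_def)
    qed
    then have fI: "f \<in> I" by (auto simp: I_def f_def)
    have f_less: "f u < f v" if uv: "(u, v) \<in> A" for u v
    proof -
      have lt: "u < r" "v < r" using uv by (auto simp: A_def orient_def)
      have "{w \<in> {..<r}. (w, u) \<in> A\<^sup>+} \<subseteq> {w \<in> {..<r}. (w, v) \<in> A\<^sup>+}"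
        using uv by (auto intro: trancl_into_trancl)
      moreover have "u \<in> {w \<in> {..<r}. (w, v) \<in> A\<^sup>+}" "u \<notin> {w \<in> {..<r}. (w, u) \<in> A\<^sup>+}"
        using uv lt acy by auto
      ultimately have "card {w \<in> {..<r}. (w, u) \<in> A\<^sup>+} < card {w \<in> {..<r}. (w, v) \<in> A\<^sup>+}"
        by (intro psubset_card_mono) auto
      then show ?thesis using lt by (simp add: f_def)
    qed
    have finB: "finite B"
      by (rule finite_subset[of _ "{..<r} \<times> {..<r}"]) (use B(2) in \<open>auto simp: orient_def\<close>)
    \<comment> \<open>An arc that does not increase \<open>f\<close> cannot belong to
      \<open>A\<close>, so it was deleted with \<open>B\<close>.\<close>
    have "sd S f \<subseteq> (\<lambda>(i, j). {i, j}) ` B"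
    proof
      fix e assume e: "e \<in> sd S f"
      then have "e \<in> N" using B(1) UN by (auto simp: sd_def)
      then obtain i j where ij: "e = {i, j}" "i < j" "j < r"
        by (auto simp: N_def ordered_nsets_2_eq)
      have U: "e \<in> U f \<longleftrightarrow> f i \<le> f j"
        using ij by (auto simp: U_def doubleton_eq_iff)
      show "e \<in> (\<lambda>(i, j). {i, j}) ` B"
      proof (cases "e \<in> S")
        case True
        then have "(i, j) \<in> orient r S" "\<not> f i < f j"
          using e U ij by (auto simp: sd_def orient_def)
        then have "(i, j) \<in> B" using f_less by (auto simp: A_def)
        then show ?thesis using ij(1) by force
      next
        case False
        then have "(j, i) \<in> orient r S" "\<not> f j < f i"
          using e U ij by (auto simp: sd_def orient_def insert_commute)
        then have "(j, i) \<in> B" using f_less by (auto simp: A_def)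
        then show ?thesis using ij(1) by (force simp: insert_commute)
      qed
    qed
    then have "card (sd S f) \<le> card ((\<lambda>(i, j). {i, j}) ` B)" using finB by (intro card_mono) auto
    also have "\<dots> \<le> card B" by (rule card_image_le[OF finB])
    finally have "S \<in> Z f" using B(1,4) by (simp add: Z_def)
    with fI show "S \<in> (\<Union>f\<in>I. Z f)" by blast
  qed
  then have "card {S \<in> Pow N. \<exists>B\<subseteq>orient r S. acyclic (orient r S - B) \<and> real (card B) < M}
      \<le> card (\<Union>f\<in>I. Z f)"
    using finN finI by (intro card_mono) (auto simp: Z_def)
  also have "\<dots> \<le> (\<Sum>f\<in>I. card (Z f))" by (rule card_UN_le[OF finI])
  finally have "real (card {S \<in> Pow N. \<exists>B\<subseteq>orient r S. acyclic (orient r S - B) \<and> real (card B) < M}) * x powr M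
      \<le> real (\<Sum>f\<in>I. card (Z f)) * x powr M"
    by (intro mult_right_mono) (auto simp del: of_nat_sum)
  also have "\<dots> = (\<Sum>f\<in>I. real (card (Z f)) * x powr M)" by (simp add: sum_distrib_right)
  also have "\<dots> \<le> (\<Sum>f\<in>I. (1 + x) ^ (r choose 2))" by (intro sum_mono Z)
  also have "\<dots> = real (r ^ r) * (1 + x) ^ (r choose 2)"
    by (simp add: I_def card_PiE)
  finally show ?thesis by (simp add: N_def)
qed

text \<open>For \<open>x = 1 - 2 * \<epsilon>\<close> the square of \<open>(1 + x) / 2\<close>
  equals \<open>x + \<epsilon>^2\<close>. This bounds its logarithm by
  \<open>ln x / 2 + \<epsilon>^2\<close>, and \<open>ln x \<le> - 2 * \<epsilon>\<close>
  finishes.\<close>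

lemma chernoff_bound:
  fixes \<epsilon> :: real
  assumes "0 < \<epsilon>" "\<epsilon> \<le> 1 / 4"
  shows "(1 + (1 - 2 * \<epsilon>)) ^ N / (1 - 2 * \<epsilon>) powr ((1 / 2 - \<epsilon>) * real N) \<le> 2 ^ N * exp (- (\<epsilon>\<^sup>2 * real N))"
proof -
  define x where "x = 1 - 2 * \<epsilon>"
  have x: "x \<ge> 1 / 2" "x < 1" using assms by (auto simp: x_def)
  have lnx: "ln x \<le> - 2 * \<epsilon>" using ln_le_minus_one[of x] x by (simp add: x_def)
  have "2 * ln ((1 + x) / 2) - ln x = ln (((1 + x) / 2)\<^sup>2 / x)"
    using x by (simp add: ln_div ln_realpow)
  also have "((1 + x) / 2)\<^sup>2 / x = 1 + \<epsilon>\<^sup>2 / x"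
    using x by (simp add: x_def field_simps power2_eq_square)
  also have "ln (1 + \<epsilon>\<^sup>2 / x) \<le> \<epsilon>\<^sup>2 / x" using x by (intro ln_add_one_self_le_self) auto
  also have "\<epsilon>\<^sup>2 / x \<le> 2 * \<epsilon>\<^sup>2" using x assms by (simp add: field_simps)
  finally have A: "ln ((1 + x) / 2) \<le> ln x / 2 + \<epsilon>\<^sup>2" by simp
  have "ln ((1 + x) / 2) - (1 / 2 - \<epsilon>) * ln x \<le> \<epsilon>\<^sup>2 + \<epsilon> * ln x"
    using A by (simp add: algebra_simps)
  also have "\<dots> \<le> \<epsilon>\<^sup>2 + \<epsilon> * (- 2 * \<epsilon>)"
    using lnx assms by (intro add_left_mono mult_left_mono) auto
  finally have B: "ln ((1 + x) / 2) - (1 / 2 - \<epsilon>) * ln x \<le> - \<epsilon>\<^sup>2" by (simp add: power2_eq_square)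
  have "(1 + x) ^ N = 2 ^ N * ((1 + x) / 2) ^ N" by (simp add: power_divide)
  also have "((1 + x) / 2) ^ N = exp (real N * ln ((1 + x) / 2))"
    using x by (simp add: exp_of_nat_mult)
  finally have "(1 + x) ^ N / x powr ((1 / 2 - \<epsilon>) * real N)
      = 2 ^ N * (exp (real N * ln ((1 + x) / 2)) / exp ((1 / 2 - \<epsilon>) * real N * ln x))"
    using x by (simp add: powr_def)
  also have "exp (real N * ln ((1 + x) / 2)) / exp ((1 / 2 - \<epsilon>) * real N * ln x)
      = exp (real N * (ln ((1 + x) / 2) - (1 / 2 - \<epsilon>) * ln x))"
    by (simp add: algebra_simps flip: exp_diff)
  also have "\<dots> \<le> exp (real N * (- \<epsilon>\<^sup>2))"
    using B unfolding exp_le_cancel_iff by (rule mult_left_mono) simp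
  finally show ?thesis by (simp add: x_def mult.commute)
qed

text \<open>With \<open>r = 2 ^ m\<close>, the relative deficit of the feedback bound, about
  \<open>1 / (16 * m)\<close>, stays below \<open>1 / w\<close> for \<open>w = 4 * m\<close>. This
  comparison drives the improved lower bound.\<close>

theorem exists_tournament_large_feedback:
  "\<forall>\<^sub>F m in sequentially. \<exists>R :: (nat \<times> nat) set. tournament_on {..<2 ^ m} R \<and>
     (\<forall>X\<subseteq>{..<2 ^ m}. \<not> transitive_set R (Suc (4 * m)) X) \<and>
     (\<forall>B\<subseteq>R. acyclic (R - B) \<longrightarrow>
        (1 / 2 - 1 / (32 * real m)) * (2 ^ m * (2 ^ m - 1) / 2) \<le> real (card B))"
proof -
  \<comment> \<open>\<open>ev1\<close> says that the Chernoff factor beats the \<open>r ^ r\<close>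
    rank functions with a factor of two to spare; \<open>ev2\<close> bounds \<open>k / r\<close> in
    the count of transitive sets.\<close>
  have ev1: "\<forall>\<^sub>F m in sequentially. real m * 2 ^ m * ln 2 - (2 ^ m * (2 ^ m - 1) / 2) / (32 * real m)\<^sup>2 < - ln 2"
    by real_asymp
  have ev2: "\<forall>\<^sub>F m in sequentially. (4 * real m + 1) / 2 ^ m < 1 / 2"
    by real_asymp
  have ev3: "\<forall>\<^sub>F m in sequentially. m \<ge> (1::nat)" by (rule eventually_ge_at_top)
  show ?thesis
    using ev1 ev2 ev3
  proof eventually_elim
    case (elim m)
    define r :: nat where "r = 2 ^ m"
    define k where "k = Suc (4 * m)"
    define N where "N = r choose 2"
    define \<epsilon> where "\<epsilon> = 1 / (32 * real m)"
    define M where "M = (1 / 2 - \<epsilon>) * real N"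
    define x where "x = 1 - 2 * \<epsilon>"
    have \<epsilon>: "0 < \<epsilon>" "\<epsilon> \<le> 1 / 4" using elim(3) by (auto simp: \<epsilon>_def field_simps)
    have x: "0 < x" "x \<le> 1" using \<epsilon> by (auto simp: x_def)
    have Nr: "real N = 2 ^ m * (2 ^ m - 1) / 2" by (simp add: N_def real_choose_two r_def)
    define Z1 where "Z1 = {S \<in> Pow (nsets {..<r} 2). \<exists>X\<subseteq>{..<r}. transitive_set (orient r S) k X}"
    define Z2 where "Z2 = {S \<in> Pow (nsets {..<r} 2).
      \<exists>B\<subseteq>orient r S. acyclic (orient r S - B) \<and> real (card B) < M}"
    have Z1: "2 * real (card Z1) \<le> 2 ^ N"
    proof -
      \<comment> \<open>For \<open>k = 4 * m + 1\<close> the power \<open>2 ^ (k choose 2)\<close>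
        is exactly \<open>r ^ (2 * k)\<close>, so the bad fraction is at most
        \<open>(k / r) ^ k\<close>.\<close>
      have "k choose 2 = k * (2 * m)" by (simp add: choose_two k_def)
      then have "card Z1 * 2 ^ (k * (2 * m)) \<le> r ^ k * k ^ k * 2 ^ N"
        using card_few_transitive[of r k] by (simp add: Z1_def N_def)
      then have "real (card Z1 * 2 ^ (k * (2 * m))) \<le> real (r ^ k * k ^ k * 2 ^ N)"
        by (simp only: of_nat_le_iff)
      moreover have "real (2 ^ (k * (2 * m))) = (2 ^ m * 2 ^ m) ^ k"
      proof -
        have "k * (2 * m) = (m + m) * k" by simp
        then show ?thesis
          by (simp only: power_mult power_add of_nat_power of_nat_mult of_nat_numeral)
      qed
      ultimately have "real (card Z1) * (2 ^ m * 2 ^ m) ^ k \<le> (2 ^ m) ^ k * real k ^ k * 2 ^ N"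
        by (simp add: r_def)
      then have "real (card Z1) * (2 ^ m) ^ k \<le> real k ^ k * 2 ^ N"
        by (simp add: power_mult_distrib mult_ac)
      then have "real (card Z1) \<le> (real k / 2 ^ m) ^ k * 2 ^ N"
        by (simp add: field_simps)
      also have "\<dots> \<le> (1 / 2) ^ k * 2 ^ N"
        using elim(2) by (intro mult_right_mono power_mono) (auto simp: k_def)
      also have "\<dots> \<le> (1 / 2) * 2 ^ N"
        by (intro mult_right_mono) (auto simp: k_def power_le_one)
      finally show ?thesis by simp
    qed
    have Z2: "2 * real (card Z2) < 2 ^ N"
    proof -
      have "real (card Z2) * x powr M \<le> real (r ^ r) * (1 + x) ^ N"
        using card_few_feedback[OF x] by (simp add: Z2_def N_def)
      then have "real (card Z2) \<le> real (r ^ r) * ((1 + x) ^ N / x powr M)"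
        using x by (simp add: field_simps)
      also have "\<dots> \<le> real (r ^ r) * (2 ^ N * exp (- (\<epsilon>\<^sup>2 * real N)))"
        using chernoff_bound[OF \<epsilon>, of N] by (intro mult_left_mono) (auto simp: x_def M_def)
      also have "real (r ^ r) = exp (real m * 2 ^ m * ln 2)"
      proof -
        have "real (r ^ r) = real r ^ r" by simp
        also have "real r = exp (real m * ln 2)" by (simp add: r_def exp_of_nat_mult)
        also have "\<dots> ^ r = exp (real r * (real m * ln 2))" by (rule exp_of_nat_mult[symmetric])
        finally show ?thesis by (simp add: r_def mult_ac)
      qed
      also have "exp (real m * 2 ^ m * ln 2) * (2 ^ N * exp (- (\<epsilon>\<^sup>2 * real N)))
          = 2 ^ N * exp (real m * 2 ^ m * ln 2 - \<epsilon>\<^sup>2 * real N)"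
        by (simp add: exp_diff exp_minus field_simps)
      also have "\<dots> < 2 ^ N * exp (- ln 2)"
      proof -
        have "real m * 2 ^ m * ln 2 - \<epsilon>\<^sup>2 * real N < - ln 2"
          using elim(1) by (simp add: Nr \<epsilon>_def power_divide)
        then show ?thesis by simp
      qed
      finally show ?thesis by (simp add: exp_minus)
    qed
    \<comment> \<open>\<open>Z1\<close> takes at most half and \<open>Z2\<close> strictly less than
      half of all choices, so some \<open>S\<close> avoids both.\<close>
    have "card (Z1 \<union> Z2) \<le> card Z1 + card Z2" by (rule card_Un_le)
    then have "real (card (Z1 \<union> Z2)) < 2 ^ N" using Z1 Z2 by linarith
    also have "(2 :: real) ^ N = real (card (Pow (nsets {..<r} 2)))"
      by (simp add: card_Pow finite_imp_finite_nsets card_nsets N_def)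
    finally have "card (Z1 \<union> Z2) < card (Pow (nsets {..<r} 2))" by simp
    moreover have "finite (Z1 \<union> Z2)"
      by (rule finite_subset[of _ "Pow (nsets {..<r} 2)"]) (auto simp: Z1_def Z2_def finite_imp_finite_nsets)
    ultimately obtain S where S: "S \<in> Pow (nsets {..<r} 2)" "S \<notin> Z1 \<union> Z2"
      by (metis card_mono not_le subsetI)
    have "tournament_on {..<r} (orient r S)" by (rule tournament_orient)
    moreover have "\<forall>X\<subseteq>{..<r}. \<not> transitive_set (orient r S) k X"
      using S by (auto simp: Z1_def)
    moreover have "\<forall>B\<subseteq>orient r S. acyclic (orient r S - B) \<longrightarrow> M \<le> real (card B)"
      using S by (auto simp: Z2_def not_less)
    moreover have "M = (1 / 2 - 1 / (32 * real m)) * (2 ^ m * (2 ^ m - 1) / 2)"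
      by (simp only: M_def Nr \<epsilon>_def)
    ultimately show ?case unfolding r_def k_def by (intro exI[of _ "orient (2 ^ m) S"]) simp
  qed
qed

subsection \<open>The asymptotic bounds\<close>

text \<open>With \<open>q = n div r\<close> the blow-up misses fewer than \<open>r\<close> vertices,
  a loss factor of at least \<open>(1 - r / n)^2\<close>, which tends to \<open>1\<close>. Here
  \<beta> is either of the two bounds per set.\<close>

lemma blowup_eventually:
  fixes f c \<beta> :: real
  assumes R: "tournament_on {..<r} R" and r: "r \<ge> 2" and w: "w \<ge> 1" and k: "k \<ge> 2"
    and f: "0 \<le> f" "\<And>B. B \<subseteq> R \<Longrightarrow> acyclic (R - B) \<Longrightarrow> f \<le> real (card B)"
    and no_transitive: "\<And>X. X \<subseteq> {..<r} \<Longrightarrow> \<not> transitive_set R (Suc w) X"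
    and \<beta>: "\<beta> = real (k choose 2) \<or> \<beta> = (1 - 1 / real w) * (real k)\<^sup>2 / 2" "\<beta> > 0"
    and c: "c < f / ((real r)\<^sup>2 * \<beta>)"
  shows "\<forall>\<^sub>F n in sequentially. c \<le> real (max_inv_num k n) / (real n)\<^sup>2"
proof -
  have "(\<lambda>n. 1 - real r / real n) \<longlonglongrightarrow> 1 - 0"
    by (intro tendsto_diff tendsto_const lim_const_over_n)
  then have "(\<lambda>n. f / ((real r)\<^sup>2 * \<beta>) * (1 - real r / real n)\<^sup>2) \<longlonglongrightarrow> f / ((real r)\<^sup>2 * \<beta>) * (1 - 0)\<^sup>2"
    by (intro tendsto_mult tendsto_const tendsto_power)
  then have "\<forall>\<^sub>F n in sequentially. c < f / ((real r)\<^sup>2 * \<beta>) * (1 - real r / real n)\<^sup>2"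
    by (rule order_tendstoD) (use c in simp)
  moreover have "\<forall>\<^sub>F n in sequentially. n \<ge> r" by (rule eventually_ge_at_top)
  ultimately show ?thesis
  proof eventually_elim
    case (elim n)
    define q where "q = n div r"
    have n_pos: "real n > 0" using elim(2) r by simp
    have q: "q \<ge> 1" "r * q \<le> n"
      using elim(2) r by (simp_all add: q_def div_greater_zero_iff Suc_le_eq)
    interpret blowup R r q n f w
      using R r q w f(2) no_transitive by unfold_locales auto
    have up: "f * (real q)\<^sup>2 \<le> real (max_inv_num k n) * \<beta>"
      using max_inv_num_lower[OF k] \<beta>(1) by metis
    have "n = r * q + n mod r" by (simp add: q_def)
    moreover have "n mod r < r" using r by simp
    ultimately have "n \<le> r * q + r" by linarith
    then have "real n \<le> real r * real q + real r" by (metis of_nat_add of_nat_le_iff of_nat_mult)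
    then have "real n / real n \<le> (real r * real q + real r) / real n"
      by (rule divide_right_mono) simp
    then have "1 - real r / real n \<le> real r * real q / real n"
      using n_pos by (simp add: add_divide_distrib)
    moreover have "0 \<le> 1 - real r / real n" using elim(2) n_pos by (simp add: field_simps)
    ultimately have sq: "(1 - real r / real n)\<^sup>2 \<le> (real r * real q / real n)\<^sup>2"
      by (intro power_mono)
    have "c \<le> f / ((real r)\<^sup>2 * \<beta>) * (1 - real r / real n)\<^sup>2" using elim(1) by simp
    also have "\<dots> \<le> f / ((real r)\<^sup>2 * \<beta>) * (real r * real q / real n)\<^sup>2"
      using sq f(1) \<beta>(2) by (intro mult_left_mono) auto
    also have "\<dots> = f * (real q)\<^sup>2 / (\<beta> * (real n)\<^sup>2)"
      using r by (simp add: power_mult_distrib power_divide)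
    also have "\<dots> \<le> real (max_inv_num k n) * \<beta> / (\<beta> * (real n)\<^sup>2)"
      using up \<beta>(2) by (intro divide_right_mono) auto
    also have "\<dots> = real (max_inv_num k n) / (real n)\<^sup>2" using \<beta>(2) by simp
    finally show ?case .
  qed
qed

text \<open>
  This is \<open>f / r\<^sup>2\<close> for \<open>r = 2 ^ m\<close> and the lower bound \<open>f\<close> on feedback arc sets in
  \<open>exists_tournament_large_feedback\<close>.
\<close>

definition feedback_density :: "nat \<Rightarrow> real" where
  "feedback_density m = (1 / 2 - 1 / (32 * real m)) * ((2 ^ m - 1) / (2 * 2 ^ m))"

text \<open>The order of quantifiers matters: \<open>m\<close>, and with it the tournament, is fixed
  before \<open>k\<close>, so that \<open>k\<close> can later be taken large relative to
  \<open>m\<close>.\<close>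

lemma max_inv_num_blowup:
  "\<forall>\<^sub>F m in sequentially. \<forall>k c \<beta>. k \<ge> 2 \<longrightarrow>
    \<beta> = real (k choose 2) \<or> \<beta> = (1 - 1 / (4 * real m)) * (real k)\<^sup>2 / 2 \<longrightarrow>
    c < feedback_density m / \<beta> \<longrightarrow>
    (\<forall>\<^sub>F n in sequentially. c \<le> real (max_inv_num k n) / (real n)\<^sup>2)"
proof -
  have "\<forall>\<^sub>F m in sequentially. m \<ge> (1::nat)" by (rule eventually_ge_at_top)
  with exists_tournament_large_feedback show ?thesis
  proof eventually_elim
    case (elim m)
    define f where "f = (1 / 2 - 1 / (32 * real m)) * (2 ^ m * (2 ^ m - 1) / 2)"
    obtain R :: "(nat \<times> nat) set" where R: "tournament_on {..<2 ^ m} R"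
      "\<And>X. X \<subseteq> {..<2 ^ m} \<Longrightarrow> \<not> transitive_set R (Suc (4 * m)) X"
      "\<And>B. B \<subseteq> R \<Longrightarrow> acyclic (R - B) \<Longrightarrow> f \<le> real (card B)"
      using elim(1) unfolding f_def by blast
    show ?case
    proof (intro allI impI)
      fix k :: nat and c \<beta> :: real
      assume k: "k \<ge> 2" and \<beta>: "\<beta> = real (k choose 2) \<or> \<beta> = (1 - 1 / (4 * real m)) * (real k)\<^sup>2 / 2"
        and c: "c < feedback_density m / \<beta>"
      have "real (k choose 2) > 0" using k by simp
      moreover have "(1 - 1 / (4 * real m)) * (real k)\<^sup>2 / 2 > 0" using k elim(2) by simp
      ultimately have \<beta>0: "\<beta> > 0" using \<beta> by blast
      have "(1::nat) < 2 ^ m" using elim(2) by (intro one_less_power) auto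
      then have r: "(2::nat) \<le> 2 ^ m" by linarith
      have "(1::real) \<le> 2 ^ m" by simp
      moreover have "1 / (32 * real m) \<le> 1 / 2" using elim(2) by (simp add: field_simps)
      ultimately have f0: "0 \<le> f" unfolding f_def by (intro mult_nonneg_nonneg) auto
      have "f / ((2 ^ m)\<^sup>2 * \<beta>) = feedback_density m / \<beta>"
        by (simp add: f_def feedback_density_def power2_eq_square)
      then have c': "c < f / ((real (2 ^ m))\<^sup>2 * \<beta>)" using c by simp
      show "\<forall>\<^sub>F n in sequentially. c \<le> real (max_inv_num k n) / (real n)\<^sup>2"
        by (rule blowup_eventually[OF R(1) r _ k f0 R(3) R(2) _ \<beta>0 c'])
          (use \<beta> elim(2) in auto)
    qed
  qed
qed

text \<open>As \<open>m\<close> grows, the density tends to \<open>1 / 4\<close>, and dividing by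
  \<open>k choose 2\<close> gives the claimed constant.\<close>

theorem max_inv_num_lower_asymptotic:
  assumes k: "k \<ge> 2" and c: "c < 1 / (2 * real k * (real k - 1))"
  shows "\<forall>\<^sub>F n in sequentially. c \<le> real (max_inv_num k n) / (real n)\<^sup>2"
proof -
  have "feedback_density \<longlonglongrightarrow> 1 / 4"
    unfolding feedback_density_def by real_asymp
  then have "(\<lambda>m. feedback_density m / real (k choose 2)) \<longlonglongrightarrow> (1 / 4) / real (k choose 2)"
    by (intro tendsto_divide tendsto_const) (use k in auto)
  also have "(1 / 4) / real (k choose 2) = 1 / (2 * real k * (real k - 1))"
    by (simp add: real_choose_two)
  finally have "\<forall>\<^sub>F m in sequentially. c < feedback_density m / real (k choose 2)"
    by (rule order_tendstoD(1)) (rule c)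
  from eventually_happens[OF eventually_conj[OF this max_inv_num_blowup]]
  show ?thesis using k by auto
qed

text \<open>For fixed \<open>m\<close> the Turan estimate gains a factor
  \<open>1 - 1 / (4 * m)\<close>. Half of this pays for the density deficit and half for
  \<open>k^2\<close> in place of \<open>k * (k - 1)\<close>, which is affordable once
  \<open>k \<ge> 8 * m\<close>.\<close>

theorem max_inv_num_lower_improved:
  "\<exists>k0. \<forall>k\<ge>k0. \<exists>\<delta>>0. \<forall>\<^sub>F n in sequentially.
     1 / (2 * real k * (real k - 1)) + \<delta> \<le> real (max_inv_num k n) / (real n)\<^sup>2"
proof -
  \<comment> \<open>The density is \<open>(1 / 4) * (1 - 1 / (16 * m)) * (1 - 1 / 2 ^ m)\<close>,
    and \<open>1 / 2 ^ m\<close> is eventually negligible against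
    \<open>1 / (16 * m)\<close>.\<close>
  have "\<forall>\<^sub>F m in sequentially. (1 / 4) * (1 - 1 / (8 * real m)) < feedback_density m"
    unfolding feedback_density_def by real_asymp
  from eventually_happens'[OF sequentially_bot
      eventually_conj[OF this eventually_conj[OF eventually_ge_at_top[of 1] max_inv_num_blowup]]]
  obtain m :: nat where m: "(1 / 4) * (1 - 1 / (8 * real m)) < feedback_density m" "m \<ge> 1"
    and low: "\<forall>k c \<beta>. k \<ge> 2 \<longrightarrow>
      \<beta> = real (k choose 2) \<or> \<beta> = (1 - 1 / (4 * real m)) * (real k)\<^sup>2 / 2 \<longrightarrow>
      c < feedback_density m / \<beta> \<longrightarrow>
      (\<forall>\<^sub>F n in sequentially. c \<le> real (max_inv_num k n) / (real n)\<^sup>2)"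
    by blast
  have "\<exists>\<delta>>0. \<forall>\<^sub>F n in sequentially.
     1 / (2 * real k * (real k - 1)) + \<delta> \<le> real (max_inv_num k n) / (real n)\<^sup>2"
    if k: "k \<ge> 8 * m" for k
  proof -
    define \<beta> where "\<beta> = (1 - 1 / (4 * real m)) * (real k)\<^sup>2 / 2"
    define L where "L = 1 / (2 * real k * (real k - 1))"
    have k2: "k \<ge> 2" using k m(2) by simp
    have \<beta>: "\<beta> > 0" using k2 m(2) by (simp add: \<beta>_def)
    have "real k \<ge> 8 * real m" using k by (metis of_nat_le_iff of_nat_mult of_nat_numeral)
    then have "1 \<le> real k / (8 * real m)" using m(2) by simp
    moreover have "(1 - 1 / (8 * real m)) * (real k - 1)
        = (1 - 1 / (4 * real m)) * real k + (real k / (8 * real m) - 1) + 1 / (8 * real m)"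
      using m(2) by (simp add: field_simps)
    moreover have "0 \<le> 1 / (8 * real m)" by simp
    ultimately have "(1 - 1 / (4 * real m)) * real k \<le> (1 - 1 / (8 * real m)) * (real k - 1)"
      by linarith
    then have le: "(1 - 1 / (4 * real m)) * real k / (real k - 1) \<le> 1 - 1 / (8 * real m)"
      using k2 by (simp add: pos_divide_le_eq)
    have "L * \<beta> = (1 / 4) * ((1 - 1 / (4 * real m)) * real k / (real k - 1))"
      using k2 by (simp add: L_def \<beta>_def power2_eq_square)
    also have "\<dots> \<le> (1 / 4) * (1 - 1 / (8 * real m))"
      using le by (rule mult_left_mono) simp
    also have "\<dots> < feedback_density m" by (rule m(1))
    finally have "L * \<beta> < feedback_density m" .
    then have "L < feedback_density m / \<beta>" using \<beta> by (simp add: pos_less_divide_eq)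
    \<comment> \<open>An intermediate \<open>c\<close> turns the strict inequality into the positive
      gain \<open>c - L\<close>.\<close>
    then obtain c where c: "L < c" "c < feedback_density m / \<beta>" using dense by blast
    have "\<forall>\<^sub>F n in sequentially. c \<le> real (max_inv_num k n) / (real n)\<^sup>2"
      by (rule low[rule_format, OF k2 disjI2 c(2)]) (rule \<beta>_def)
    then show ?thesis using c(1) by (intro exI[of _ "c - L"]) (simp add: L_def)
  qed
  then show ?thesis by blast
qed

text \<open>The error is the positive part of \<open>L - x n\<close>. The lemma also serves for
  upper bounds, applied to the negated sequence.\<close>

lemma lower_error_term:
  fixes x :: "nat \<Rightarrow> real"
  assumes "\<And>c. c < L \<Longrightarrow> \<forall>\<^sub>F n in sequentially. c \<le> x n"
  shows "\<exists>g\<in>o(\<lambda>_. 1). \<forall>n. L - g n \<le> x n"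
proof -
  define g where "g n = max 0 (L - x n)" for n
  have "g \<longlonglongrightarrow> 0"
  proof (rule tendstoI)
    fix e :: real assume e: "e > 0"
    have "\<forall>\<^sub>F n in sequentially. L - e / 2 \<le> x n" using e by (intro assms) auto
    then show "\<forall>\<^sub>F n in sequentially. dist (g n) 0 < e"
      by eventually_elim (use e in \<open>auto simp: g_def dist_real_def\<close>)
  qed
  then have "g \<in> o(\<lambda>_. 1)" by (intro smalloI_tendsto) auto
  moreover have "L - g n \<le> x n" for n by (simp add: g_def)
  ultimately show ?thesis by blast
qed

theorem theorem1p4:
  shows "(\<forall>k::nat. k \<ge> 3 \<longrightarrow>
            (\<exists>\<epsilon>::real. \<epsilon> > 0 \<and>
              (\<exists>g\<in>o(\<lambda>_::nat. 1::real). \<exists>h\<in>o(\<lambda>_::nat. 1::real). \<forall>n\<ge>1.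
                 1 / (2 * real k * (real k - 1)) - g n \<le> real (max_inv_num k n) / (real n)\<^sup>2 \<and>
                 real (max_inv_num k n) / (real n)\<^sup>2
                   \<le> 1 / (2 * real_of_int \<lfloor>(real k)\<^sup>2 / 2\<rfloor>) - \<epsilon> + h n)))
       \<and> (\<exists>k0::nat. \<forall>k\<ge>k0. \<exists>\<delta>::real. \<delta> > 0 \<and>
            (\<exists>g\<in>o(\<lambda>_::nat. 1::real). \<forall>n\<ge>1.
               real (max_inv_num k n) / (real n)\<^sup>2
                 \<ge> 1 / (2 * real k * (real k - 1)) + \<delta> - g n))"
proof (intro conjI allI impI)
  fix k :: nat
  assume k: "k \<ge> 3"
  define x where "x n = real (max_inv_num k n) / (real n)\<^sup>2" for n
  define U where "U = 1 / (2 * real_of_int \<lfloor>(real k)\<^sup>2 / 2\<rfloor>)"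
  define L where "L = 1 / (2 * real k * (real k - 1))"
  have "\<exists>g\<in>o(\<lambda>_. 1). \<forall>n. L - g n \<le> x n"
    using max_inv_num_lower_asymptotic[of k] k unfolding x_def L_def
    by (intro lower_error_term) auto
  then obtain g where g: "g \<in> o(\<lambda>_. 1)" "\<And>n. L - g n \<le> x n" by blast
  obtain \<epsilon> n0 where \<epsilon>: "\<epsilon> > 0"
    "\<And>n. n0 \<le> n \<Longrightarrow> real (max_inv_num k n) \<le> (U - \<epsilon>) * (real n)\<^sup>2"
    using max_inv_num_upper[OF k] unfolding U_def by blast
  \<comment> \<open>The threshold is at least \<open>1\<close> so that dividing by
    \<open>n^2\<close> is legitimate.\<close>
  have "\<forall>\<^sub>F n in sequentially. x n \<le> U - \<epsilon>"
    using eventually_ge_at_top[of "max 1 n0"]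
  proof eventually_elim
    case (elim n)
    then show ?case using \<epsilon>(2)[of n] by (simp add: x_def pos_divide_le_eq)
  qed
  then have "\<forall>\<^sub>F n in sequentially. c \<le> - x n" if "c < - (U - \<epsilon>)" for c
    by eventually_elim (use that in simp)
  then have "\<exists>h\<in>o(\<lambda>_. 1). \<forall>n. - (U - \<epsilon>) - h n \<le> - x n" by (rule lower_error_term)
  then obtain h where h: "h \<in> o(\<lambda>_. 1)" "\<And>n. - (U - \<epsilon>) - h n \<le> - x n" by blast
  then have "x n \<le> U - \<epsilon> + h n" for n using h(2)[of n] by linarith
  with \<epsilon>(1) g h(1)
  show "\<exists>\<epsilon>::real. \<epsilon> > 0 \<and>
              (\<exists>g\<in>o(\<lambda>_::nat. 1::real). \<exists>h\<in>o(\<lambda>_::nat. 1::real). \<forall>n\<ge>1.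
                 1 / (2 * real k * (real k - 1)) - g n \<le> real (max_inv_num k n) / (real n)\<^sup>2 \<and>
                 real (max_inv_num k n) / (real n)\<^sup>2
                   \<le> 1 / (2 * real_of_int \<lfloor>(real k)\<^sup>2 / 2\<rfloor>) - \<epsilon> + h n)"
    unfolding x_def U_def L_def by blast
next
  obtain k0 where k0: "\<And>k. k \<ge> k0 \<Longrightarrow> \<exists>\<delta>>0. \<forall>\<^sub>F n in sequentially.
     1 / (2 * real k * (real k - 1)) + \<delta> \<le> real (max_inv_num k n) / (real n)\<^sup>2"
    using max_inv_num_lower_improved by blast
  have "\<exists>\<delta>::real. \<delta> > 0 \<and> (\<exists>g\<in>o(\<lambda>_::nat. 1::real). \<forall>n\<ge>1.
               real (max_inv_num k n) / (real n)\<^sup>2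
                 \<ge> 1 / (2 * real k * (real k - 1)) + \<delta> - g n)" if "k \<ge> k0" for k
  proof -
    obtain \<delta> where \<delta>: "\<delta> > 0" "\<forall>\<^sub>F n in sequentially.
       1 / (2 * real k * (real k - 1)) + \<delta> \<le> real (max_inv_num k n) / (real n)\<^sup>2"
      using k0[OF \<open>k \<ge> k0\<close>] by blast
    have "\<exists>g\<in>o(\<lambda>_. 1). \<forall>n. 1 / (2 * real k * (real k - 1)) + \<delta> - g n \<le> real (max_inv_num k n) / (real n)\<^sup>2"
    proof (rule lower_error_term)
      show "\<forall>\<^sub>F n in sequentially. c \<le> real (max_inv_num k n) / (real n)\<^sup>2"
        if "c < 1 / (2 * real k * (real k - 1)) + \<delta>" for c
        using \<delta>(2) by eventually_elim (use that in linarith)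
    qed
    with \<delta>(1) show ?thesis by blast
  qed
  then show "\<exists>k0::nat. \<forall>k\<ge>k0. \<exists>\<delta>::real. \<delta> > 0 \<and>
            (\<exists>g\<in>o(\<lambda>_::nat. 1::real). \<forall>n\<ge>1.
               real (max_inv_num k n) / (real n)\<^sup>2
                 \<ge> 1 / (2 * real k * (real k - 1)) + \<delta> - g n)" by blast
qed

end
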